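(* Let $r$ be a positive integer or $\infty$ and $n\ge0$. Each of the following is a basis of $\mathrm{QSym}^r_n(x)$, where $(\beta,\mu)$ ranges over $r$-compositions of $n$: (1) $\{M_{(\beta,\mu)}\}$; (2) $\{S_{(\beta,\mu)}\}$; (3) $\{\overline{F}_{(\beta,\mu)}\}$; (4) $\{\overline{S}_{(\beta,\mu)}\}$.
   Context: An $r$-composition of $n$ is a pair $(\beta,\mu)$ with $\beta=(\beta_1,\dots,\beta_k)$ a composition all of whose parts are $\ge r$, $\mu=(\mu_1,\dots,\mu_l)$ a partition all of whose parts are $<r$, and $|\beta|+|\mu|=n$. $M_{(\beta,\mu)}=\sum x_{i_1}^{\beta_1}\cdots x_{i_k}^{\beta_k}x_{i_{k+1}}^{\mu_1}\cdots x_{i_{k+l}}^{\mu_l}$ over distinct positive integers $i_1,\dots,i_{k+l}$ with $i_1<\dots<i_k$ (commuting variables); $\mathrm{QSym}^r_n(x)$ is the $\mathbb{Q}$-span of the $M_{(\beta,\mu)}$ with $(\beta,\mu)$ an $r$-composition of $n$. An edge-coloured digraph is a finite simple digraph with each edge dashed ($\dashrightarrow$), solid ($\rightarrow$) or double ($\Rightarrow$); a proper vertex-colouring is $\kappa:V\to\mathbb{P}$ with $\kappa(a)\ne\kappa(b)$, $\kappa(a)<\kappa(b)$, $\kappa(a)\le\kappa(b)$ for dashed, solid, double edges $(a,b)$ respectively; $\mathscr{X}_G(x)=\sum_\kappa\prod_{a}x_{\kappa(a)}$ over proper vertex-colourings. The dashed (resp. solid, double) sum of $G_1,G_2$ is their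 disjoint union plus a dashed (resp. solid, double) edge $(a,b)$ for all $a\in V(G_1)$, $b\in V(G_2)$. $C_m$ is the directed cycle on $m$ vertices with all edges double (a single vertex if $m=1$). For a partition $\mu=(\mu_1,\dots,\mu_l)$, $G_\mu$ has vertex set $\{(i,j):1\le i\le l,1\le j\le\mu_i\}$, solid edges $(i,j)\rightarrow(i+1,j)$ and double edges $(i,j)\Rightarrow(i,j+1)$ (so $\mathscr{X}_{G_\mu}$ is the Schur function $s_\mu$). Let $A_\beta$ be the solid sum $C_{\beta_1}$ solid-sum $\cdots$ solid-sum $C_{\beta_k}$, $B_\beta$ the double sum $C_{\beta_1}$ double-sum $\cdots$ double-sum $C_{\beta_k}$, and $D_\mu$ the dashed sum $C_{\mu_1}$ dashed-sum $\cdots$ dashed-sum $C_{\mu_l}$. Then $M_{(\beta,\mu)}=\mathscr{X}_{A_\beta\,\text{dashed-sum}\,D_\mu}$, and define $S_{(\beta,\mu)}=\mathscr{X}_{A_\beta\,\text{dashed-sum}\,G_\mu}$, $\overline{F}_{(\beta,\mu)}=\mathscr{X}_{B_\beta\,\text{dashed-sum}\,D_\mu}$, $\overline{S}_{(\beta,\mu)}=\mathscr{X}_{B_\beta\,\text{dashed-sum}\,G_\mu}$. *)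

theory Defs
  imports Main "HOL-Library.Multiset" "HOL-Library.FuncSet" "HOL-Library.Extended_Nat" "HOL-Library.Function_Algebras"
begin

text \<open>A formal power series over Q in the variables x_1, x_2, ... is represented by its
coefficient function: a monomial x_{i_1} ... x_{i_d} is the multiset of indices
{#i_1,...,i_d#}.  Indices are positive integers; multisets containing 0 simply never
occur with nonzero coefficient in the series considered below.\<close>

type_synonym series = "nat multiset \<Rightarrow> rat"

definition qscale :: "rat \<Rightarrow> series \<Rightarrow> series" where
  "qscale c f = (\<lambda>m. c * f m)"

datatype ekind = Dashed | Solid | Double

text \<open>A finite edge-coloured digraph: vertex set and an edge labelling; E a b = Some k means
there is an edge (a,b) of kind k (so at most one edge per ordered pair: a simple digraph).
Vertices are nat lists, which allows disjoint unions by tagging.\<close>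

type_synonym egraph = "nat list set \<times> (nat list \<Rightarrow> nat list \<Rightarrow> ekind option)"

fun edge_ok :: "ekind \<Rightarrow> nat \<Rightarrow> nat \<Rightarrow> bool" where
  "edge_ok Dashed i j = (i \<noteq> j)"
| "edge_ok Solid i j = (i < j)"
| "edge_ok Double i j = (i \<le> j)"

definition proper_colouring :: "egraph \<Rightarrow> (nat list \<Rightarrow> nat) \<Rightarrow> bool" where
  "proper_colouring G \<kappa> \<longleftrightarrow>
     \<kappa> \<in> fst G \<rightarrow>\<^sub>E {1..} \<and>
     (\<forall>a\<in>fst G. \<forall>b\<in>fst G. case snd G a b of None \<Rightarrow> True | Some k \<Rightarrow> edge_ok k (\<kappa> a) (\<kappa> b))"

text \<open>The generating function X_G = sum over proper colourings of prod_a x_{kappa(a)}: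
coefficient of the monomial m is the number of proper colourings with colour multiset m.\<close>

definition chromX :: "egraph \<Rightarrow> series" where
  "chromX G = (\<lambda>m. of_nat (card {\<kappa>. proper_colouring G \<kappa> \<and> image_mset \<kappa> (mset_set (fst G)) = m}))"

definition empty_graph :: egraph where
  "empty_graph = ({}, \<lambda>a b. None)"

fun gsum_edges :: "ekind \<Rightarrow> egraph \<Rightarrow> egraph \<Rightarrow> nat list \<Rightarrow> nat list \<Rightarrow> ekind option" where
  "gsum_edges k G1 G2 (0 # a) (0 # b) = snd G1 a b"
| "gsum_edges k G1 G2 (Suc 0 # a) (Suc 0 # b) = snd G2 a b"
| "gsum_edges k G1 G2 (0 # a) (Suc 0 # b) =
     (if a \<in> fst G1 \<and> b \<in> fst G2 then Some k else None)"
| "gsum_edges k G1 G2 a b = None"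

definition gsum :: "ekind \<Rightarrow> egraph \<Rightarrow> egraph \<Rightarrow> egraph" where
  "gsum k G1 G2 = ((\<lambda>v. 0 # v) ` fst G1 \<union> (\<lambda>v. Suc 0 # v) ` fst G2, gsum_edges k G1 G2)"

text \<open>Iterated sum G_1 + ... + G_k (right-nested; sums are associative up to isomorphism).\<close>

definition gsum_list :: "ekind \<Rightarrow> egraph list \<Rightarrow> egraph" where
  "gsum_list k Gs = foldr (gsum k) Gs empty_graph"

definition cycleC :: "nat \<Rightarrow> egraph" where
  "cycleC m = ({[i] | i. i < m},
     \<lambda>a b. if m \<ge> 2 \<and> (\<exists>i j. a = [i] \<and> b = [j] \<and> i < m \<and> j < m \<and> j = (i + 1) mod m)
           then Some Double else None)"

definition Gpart :: "nat list \<Rightarrow> egraph" where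
  "Gpart \<mu> = ({[i, j] | i j. 1 \<le> i \<and> i \<le> length \<mu> \<and> 1 \<le> j \<and> j \<le> \<mu> ! (i - 1)},
     \<lambda>a b. if (\<exists>i j. a = [i, j] \<and> b = [i + 1, j]) then Some Solid
           else if (\<exists>i j. a = [i, j] \<and> b = [i, j + 1]) then Some Double else None)"

definition Agraph :: "nat list \<Rightarrow> egraph" where
  "Agraph \<beta> = gsum_list Solid (map cycleC \<beta>)"

definition Bgraph :: "nat list \<Rightarrow> egraph" where
  "Bgraph \<beta> = gsum_list Double (map cycleC \<beta>)"

definition Dgraph :: "nat list \<Rightarrow> egraph" where
  "Dgraph \<mu> = gsum_list Dashed (map cycleC \<mu>)"

definition is_partition :: "nat list \<Rightarrow> bool" where
  "is_partition \<mu> \<longleftrightarrow> (\<forall>p\<in>set \<mu>. p > 0) \<and> sorted_wrt (\<ge>) \<mu>"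

definition rcomps :: "enat \<Rightarrow> nat \<Rightarrow> (nat list \<times> nat list) set" where
  "rcomps r n = {(\<beta>, \<mu>). (\<forall>b\<in>set \<beta>. b > 0 \<and> enat b \<ge> r) \<and> is_partition \<mu> \<and>
                          (\<forall>p\<in>set \<mu>. enat p < r) \<and> sum_list \<beta> + sum_list \<mu> = n}"

text \<open>M_(beta,mu): sum over tuples (i_1,...,i_{k+l}) of distinct positive integers with
i_1 < ... < i_k of x_{i_1}^{beta_1} ... x_{i_k}^{beta_k} x_{i_{k+1}}^{mu_1} ... x_{i_{k+l}}^{mu_l}.\<close>

definition Mser :: "nat list \<times> nat list \<Rightarrow> series" where
  "Mser bm = (\<lambda>m. of_nat (card {is :: nat list.
      length is = length (fst bm) + length (snd bm) \<and> distinct is \<and> (\<forall>i\<in>set is. i > 0) \<and>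
      sorted_wrt (<) (take (length (fst bm)) is) \<and>
      (\<Sum>j<length is. replicate_mset ((fst bm @ snd bm) ! j) (is ! j)) = m}))"

definition Sser :: "nat list \<times> nat list \<Rightarrow> series" where
  "Sser bm = chromX (gsum Dashed (Agraph (fst bm)) (Gpart (snd bm)))"

definition Fbar :: "nat list \<times> nat list \<Rightarrow> series" where
  "Fbar bm = chromX (gsum Dashed (Bgraph (fst bm)) (Dgraph (snd bm)))"

definition Sbar :: "nat list \<times> nat list \<Rightarrow> series" where
  "Sbar bm = chromX (gsum Dashed (Bgraph (fst bm)) (Gpart (snd bm)))"

definition QSym :: "enat \<Rightarrow> nat \<Rightarrow> series set" where
  "QSym r n = module.span qscale (Mser ` rcomps r n)"

definition is_basis_family :: "series set \<Rightarrow> ('i \<Rightarrow> series) \<Rightarrow> 'i set \<Rightarrow> bool" where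
  "is_basis_family W b I \<longleftrightarrow>
     inj_on b I \<and> \<not> module.dependent qscale (b ` I) \<and> module.span qscale (b ` I) = W"

end

theory Submission
  imports Defs "HOL-Combinatorics.Permutations"
begin

text \<open>The multiplicities at least \<open>r\<close> of a monomial, read in the order of the variables, together
  with the remaining ones, sorted decreasingly, form an \<open>r\<close>-composition, the type of the monomial, and
  \<open>Mser (\<beta>, \<mu>)\<close> is a positive multiple of the indicator function of the monomials of type \<open>(\<beta>, \<mu>)\<close>.
  Hence \<open>QSym r n\<close> consists of the series of degree \<open>n\<close> whose coefficients depend only on the type.
  The coefficient of a monomial in one of the dashed sums at hand factors over its large and its small
  multiplicities, so the sum lies in \<open>QSym r n\<close> because the first factor is quasisymmetric and the
  second one symmetric (for Schur functions by the Bender--Knuth involution). Merging parts shortens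
  \<open>\<beta>\<close>, and a tableau of shape \<open>\<mu>\<close> has content dominated by \<open>\<mu>\<close>, so each family is triangular with
  nonzero diagonal.\<close>

text \<open>Over a field a nonzero diagonal entry is enough, so triangularity of the last three
  families needs no coefficient to be computed, only to know for which \<open>m\<close> the set
  \<open>colourings G m\<close> is empty. The natural order on types (shorter composition, dominated
  partition) is partial; the numerical \<open>comp_rank\<close> refines it, and different types of
  equal rank must not interact. The threshold \<open>r\<close> makes dashed sums tractable: on the
  composition side a whole cycle carries each colour, so it is used at least \<open>r\<close> times,
  while on the partition side dominance bounds every multiplicity by the largest part, which is
  below \<open>r\<close>. Hence the two sides never share a colour and a monomial splits in only one
  way. The hard point is the symmetry of the Schur factor: a type forgets the order of the small
  multiplicities, so quasisymmetry would not suffice there. Tableaux are encoded by the shapes of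
  their subtableaux with bounded entries, which turns the Bender-Knuth move into arithmetic on row
  lengths instead of a pairing of entries.\<close>

interpretation series: vector_space qscale
  by unfold_locales (auto simp: qscale_def fun_eq_iff algebra_simps)

lemma sum_series_apply: "(\<Sum>i\<in>A. f i) m = (\<Sum>i\<in>A. (f i :: series) m)"
  by (induction A rule: infinite_finite_induct) auto

section \<open>Class functions on monomials and triangular families\<close>

definition good :: "nat \<Rightarrow> nat multiset \<Rightarrow> bool" where
  "good n m \<longleftrightarrow> 0 \<notin># m \<and> size m = n"

text \<open>Kept abstract to separate linear algebra from combinatorics; with \<open>good n\<close>
  for \<open>P\<close> and \<open>rtype r\<close> for \<open>t\<close> it becomes
  \<open>QSym r n\<close>.\<close>

definition class_series :: "(nat multiset \<Rightarrow> bool) \<Rightarrow> (nat multiset \<Rightarrow> 'i) \<Rightarrow> series set" where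
  "class_series P t = {f. (\<forall>m. \<not> P m \<longrightarrow> f m = 0) \<and>
                          (\<forall>m m'. P m \<longrightarrow> P m' \<longrightarrow> t m = t m' \<longrightarrow> f m = f m')}"

lemma class_seriesI:
  assumes "\<And>m. \<not> P m \<Longrightarrow> f m = 0"
    and "\<And>m m'. P m \<Longrightarrow> P m' \<Longrightarrow> t m = t m' \<Longrightarrow> f m = f m'"
  shows "f \<in> class_series P t"
  using assms unfolding class_series_def by blast

lemma class_seriesD1: "f \<in> class_series P t \<Longrightarrow> \<not> P m \<Longrightarrow> f m = 0"
  unfolding class_series_def by blast

lemma class_seriesD2:
  "f \<in> class_series P t \<Longrightarrow> P m \<Longrightarrow> P m' \<Longrightarrow> t m = t m' \<Longrightarrow> f m = f m'"
  unfolding class_series_def by blast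

lemma class_series_subspace: "series.subspace (class_series P t)"
proof (rule series.subspaceI)
  fix f g assume f: "f \<in> class_series P t" and g: "g \<in> class_series P t"
  show "f + g \<in> class_series P t"
  proof (rule class_seriesI)
    fix m m' assume m: "P m" "P m'" "t m = t m'"
    show "(f + g) m = (f + g) m'"
      by (simp add: class_seriesD2[OF f m] class_seriesD2[OF g m])
  qed (simp add: class_seriesD1[OF f] class_seriesD1[OF g])
next
  fix c f assume f: "f \<in> class_series P t"
  show "qscale c f \<in> class_series P t"
    by (intro class_seriesI) (auto simp: qscale_def class_seriesD1[OF f] dest: class_seriesD2[OF f])
qed (simp add: class_series_def)

text \<open>The number \<open>rank\<close> stands for any order on the indices that it refines:
  \<open>b_tri\<close> rules out interaction between different indices of equal rank, and no linear
  order has to be chosen.\<close>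

locale triangular_family =
  fixes P :: "nat multiset \<Rightarrow> bool" and t :: "nat multiset \<Rightarrow> 'i" and I :: "'i set"
    and b :: "'i \<Rightarrow> series" and rank :: "'i \<Rightarrow> nat"
  assumes finite_I: "finite I"
    and t_in: "P m \<Longrightarrow> t m \<in> I"
    and t_onto: "i \<in> I \<Longrightarrow> \<exists>m. P m \<and> t m = i"
    and b_class: "i \<in> I \<Longrightarrow> b i \<in> class_series P t"
    and b_diag: "P m \<Longrightarrow> b (t m) m \<noteq> 0"
    and b_tri: "i \<in> I \<Longrightarrow> P m \<Longrightarrow> b i m \<noteq> 0 \<Longrightarrow> t m = i \<or> rank (t m) < rank i"
begin

text \<open>Evaluating \<open>b i = b j\<close> at monomials of types \<open>i\<close> and
  \<open>j\<close> would make each rank smaller than the other, unless \<open>i = j\<close>.\<close>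

lemma inj: "inj_on b I"
proof (rule inj_onI)
  fix i j assume ij: "i \<in> I" "j \<in> I" "b i = b j"
  obtain m where m: "P m" "t m = i" using t_onto ij by blast
  obtain m' where m': "P m'" "t m' = j" using t_onto ij by blast
  have "b j m \<noteq> 0" "b i m' \<noteq> 0" using b_diag[OF m(1)] b_diag[OF m'(1)] m m' ij by simp_all
  then have "i = j \<or> rank i < rank j" "j = i \<or> rank j < rank i"
    using b_tri[OF ij(2) m(1)] b_tri[OF ij(1) m'(1)] m m' by simp_all
  then show "i = j" by auto
qed

lemma independent: "\<not> series.dependent (b ` I)"
proof
  assume "series.dependent (b ` I)"
  then obtain u v where u: "v \<in> b ` I" "u v \<noteq> 0" "(\<Sum>v\<in>b ` I. qscale (u v) v) = 0"
    using series.dependent_finite[of "b ` I"] finite_I by auto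
  define J where "J = {i \<in> I. u (b i) \<noteq> 0}"
  have J: "finite J" "J \<noteq> {}" using u finite_I by (auto simp: J_def)
  then have "Max (rank ` J) \<in> rank ` J" by (intro Max_in) auto
  then obtain i where "i \<in> J" "rank i = Max (rank ` J)" by auto
  \<comment> \<open>An index of maximal rank among those with nonzero coefficient: at a monomial of
    this type \<open>b_tri\<close> kills every other term of the relation.\<close>
  then have i: "i \<in> J" "\<And>j. j \<in> J \<Longrightarrow> rank j \<le> rank i" using J by auto
  then obtain m where m: "P m" "t m = i" using t_onto by (auto simp: J_def)
  have "0 = (\<Sum>v\<in>b ` I. qscale (u v) v) m" using u by simp
  also have "\<dots> = (\<Sum>j\<in>I. u (b j) * b j m)"
    by (simp add: sum.reindex[OF inj] sum_series_apply qscale_def)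
  also have "\<dots> = (\<Sum>j\<in>{i}. u (b j) * b j m)"
  proof (rule sum.mono_neutral_right)
    show "\<forall>j\<in>I - {i}. u (b j) * b j m = 0"
      using b_tri[OF _ m(1)] i(2) m(2) by (fastforce simp: J_def)
  qed (use finite_I i in \<open>auto simp: J_def\<close>)
  also have "\<dots> \<noteq> 0" using b_diag[OF m(1)] m(2) i by (auto simp: J_def)
  finally show False by simp
qed

text \<open>Elimination from the top: \<open>k\<close> strictly bounds the ranks of the types on
  which \<open>f\<close> lives, and the induction step subtracts members of the family that clear
  the highest layer.\<close>

lemma in_span:
  assumes "f \<in> class_series P t" "\<And>m. P m \<Longrightarrow> rank (t m) \<ge> k \<Longrightarrow> f m = 0"
  shows "f \<in> series.span (b ` I)"
  using assms
proof (induction k arbitrary: f)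
  case 0
  then have "f = 0" 
    by (intro ext) (metis class_seriesD1 zero_fun_apply le0)
  then show ?case by (simp only: series.span_zero)
next
  case (Suc k)
  define w where "w i = (SOME m. P m \<and> t m = i)" for i
  have w: "P (w i)" "t (w i) = i" if "i \<in> I" for i
    using someI_ex[OF t_onto[OF that]] by (auto simp: w_def)
  \<comment> \<open>Members of equal rank do not interact, so the layer of rank \<open>k\<close> is
    a diagonal system, solved by quotients of values at the chosen representatives
    \<open>w i\<close>.\<close>
  define h where "h = (\<Sum>i\<in>{i\<in>I. rank i = k}. qscale (f (w i) / b i (w i)) (b i))"
  have h_span: "h \<in> series.span (b ` I)" unfolding h_def
    by (intro series.span_sum series.span_scale series.span_base) auto
  have h_class: "h \<in> class_series P t" unfolding h_def
    by (intro series.subspace_sum series.subspace_scale class_series_subspace b_class) auto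
  have "f - h \<in> series.span (b ` I)"
  proof (rule Suc.IH)
    show "f - h \<in> class_series P t"
      by (intro series.subspace_diff class_series_subspace h_class Suc)
  next
    fix m assume m: "P m" "k \<le> rank (t m)"
    let ?g = "\<lambda>i. f (w i) / b i (w i) * b i m"
    have hm: "h m = (\<Sum>i\<in>{i\<in>I. rank i = k}. ?g i)"
      by (simp add: h_def sum_series_apply qscale_def)
    have z: "?g i = 0" if "i \<in> I" "rank i = k" "i \<noteq> t m" for i
      using b_tri[OF that(1) m(1)] m(2) that by auto
    show "(f - h) m = 0"
    proof (cases "rank (t m) = k")
      case True
      have "h m = (\<Sum>i\<in>{t m}. ?g i)" unfolding hm
        by (rule sum.mono_neutral_right) (use z True finite_I t_in m in auto)
      also have "f (w (t m)) = f m" "b (t m) (w (t m)) = b (t m) m"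
        using w[OF t_in[OF m(1)]] m(1) class_seriesD2[OF Suc.prems(1)]
          class_seriesD2[OF b_class[OF t_in[OF m(1)]]] by blast+
      then have "(\<Sum>i\<in>{t m}. ?g i) = f m" using b_diag[OF m(1)] by simp
      finally show ?thesis by simp
    next
      case False
      have "h m = 0" unfolding hm by (rule sum.neutral) (use z False in auto)
      then show ?thesis using Suc.prems(2)[OF m(1)] False m by simp
    qed
  qed
  from series.span_add[OF this h_span] show ?case by simp
qed

lemma basis: "is_basis_family (class_series P t) b I"
proof -
  have "f \<in> series.span (b ` I)" if "f \<in> class_series P t" for f
  proof (rule in_span[OF that])
    show "f m = 0" if "P m" "Suc (Max (rank ` I)) \<le> rank (t m)" for m
    proof -
      have "rank (t m) \<le> Max (rank ` I)" using finite_I t_in[OF that(1)] by simp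
      then show ?thesis using that(2) by linarith
    qed
  qed
  moreover have "series.span (b ` I) \<subseteq> class_series P t"
    by (rule series.span_minimal) (use b_class class_series_subspace in auto)
  ultimately show ?thesis
    unfolding is_basis_family_def using inj independent by auto
qed

end

subsection \<open>The type of a monomial\<close>

abbreviation support_list :: "nat multiset \<Rightarrow> nat list" where
  "support_list m \<equiv> sorted_list_of_set (set_mset m)"

definition comp_of :: "nat multiset \<Rightarrow> nat list" where
  "comp_of m = map (count m) (support_list m)"

definition part_of :: "nat multiset \<Rightarrow> nat list" where
  "part_of m = rev (sort (comp_of m))"

definition big :: "enat \<Rightarrow> nat multiset \<Rightarrow> nat multiset" where
  "big r m = filter_mset (\<lambda>x. r \<le> enat (count m x)) m"

definition small :: "enat \<Rightarrow> nat multiset \<Rightarrow> nat multiset" where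
  "small r m = filter_mset (\<lambda>x. enat (count m x) < r) m"

definition rtype :: "enat \<Rightarrow> nat multiset \<Rightarrow> nat list \<times> nat list" where
  "rtype r m = (comp_of (big r m), part_of (small r m))"

lemma big_plus_small: "big r m + small r m = m"
  unfolding big_def small_def not_le[symmetric]
  by (rule multiset_partition[symmetric])

lemma set_big: "set_mset (big r m) = {x \<in> set_mset m. r \<le> enat (count m x)}"
  and set_small: "set_mset (small r m) = {x \<in> set_mset m. enat (count m x) < r}"
  by (auto simp: big_def small_def)

lemma count_big: "x \<in># big r m \<Longrightarrow> count (big r m) x = count m x"
  and count_small: "x \<in># small r m \<Longrightarrow> count (small r m) x = count m x"
  by (auto simp: big_def small_def)

text \<open>With disjoint supports, each variable has the same multiplicity in \<open>m\<close> as
  in its own part, so comparison with \<open>r\<close> decides where it belongs.\<close>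

lemma big_small_unique:
  assumes "m = m1 + m2" "set_mset m1 \<inter> set_mset m2 = {}"
    and "\<And>x. x \<in># m1 \<Longrightarrow> r \<le> enat (count m1 x)" "\<And>x. x \<in># m2 \<Longrightarrow> enat (count m2 x) < r"
  shows "m1 = big r m" "m2 = small r m"
proof -
  have c: "x \<in># m1 \<Longrightarrow> count m2 x = 0" "x \<in># m2 \<Longrightarrow> count m1 x = 0" for x
    using assms(2) by (auto simp: count_eq_zero_iff)
  show "m1 = big r m"
  proof (rule multiset_eqI)
    fix x show "count m1 x = count (big r m) x"
      using c[of x] assms(3,4)[of x] assms(1) count_eq_zero_iff[of m1 x] count_eq_zero_iff[of m2 x]
      by (cases "x \<in># m1"; cases "x \<in># m2") (auto simp: big_def)
  qed
  then show "m2 = small r m" using big_plus_small[of r m] assms(1) by simp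
qed

lemma sum_comp_of: "sum_list (comp_of m) = size m"
  by (simp add: comp_of_def sum_list_distinct_conv_sum_set size_multiset_overloaded_eq)

lemma mset_part_of: "mset (part_of m) = mset (comp_of m)"
  by (simp add: part_of_def)

lemma sum_part_of: "sum_list (part_of m) = size m"
  by (metis mset_part_of sum_comp_of sum_mset_sum_list)

lemma mset_comp_of: "mset (comp_of m) = image_mset (count m) (mset_set (set_mset m))"
  using mset_set_set[of "support_list m"] by (simp add: comp_of_def)

lemma set_comp_of: "set (comp_of m) = count m ` set_mset m"
  by (simp add: comp_of_def)

lemma set_part_of: "set (part_of m) = count m ` set_mset m"
  by (metis mset_part_of set_comp_of set_mset_mset)

lemma is_partition_part_of: "is_partition (part_of m)"
  by (auto simp: is_partition_def set_part_of) (simp add: part_of_def sorted_wrt_rev)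

lemma part_of_eqI: "is_partition \<mu> \<Longrightarrow> mset \<mu> = mset (comp_of m) \<Longrightarrow> part_of m = \<mu>"
  using properties_for_sort[of "rev \<mu>" "comp_of m"]
  by (simp add: part_of_def is_partition_def sorted_wrt_rev rev_swap)

lemma rtype_in_rcomps:
  assumes "good n m" shows "rtype r m \<in> rcomps r n"
proof -
  have "size (big r m) + size (small r m) = n"
    using assms big_plus_small[of r m] by (metis good_def size_union)
  then show ?thesis
    by (auto simp: rtype_def rcomps_def set_comp_of set_part_of is_partition_part_of
        sum_comp_of sum_part_of count_big count_small) (auto simp: set_big set_small)
qed

lemma length_le_sum_list: "\<forall>x\<in>set xs. 0 < x \<Longrightarrow> length xs \<le> sum_list (xs :: nat list)"
  by (induction xs) auto

lemma finite_rcomps: "finite (rcomps r n)"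
proof (rule finite_subset)
  let ?L = "{xs. set xs \<subseteq> {..n} \<and> length xs \<le> n}"
  show "rcomps r n \<subseteq> ?L \<times> ?L"
  proof safe
    fix \<beta> \<mu> assume "(\<beta>, \<mu>) \<in> rcomps r n"
    then have h: "\<forall>x\<in>set \<beta>. 0 < x" "\<forall>x\<in>set \<mu>. 0 < x" "sum_list \<beta> + sum_list \<mu> = n"
      by (auto simp: rcomps_def is_partition_def)
    show "length \<beta> \<le> n" "length \<mu> \<le> n" using length_le_sum_list[OF h(1)] length_le_sum_list[OF h(2)] h(3)
      by linarith+
    show "x \<le> n" if "x \<in> set \<beta>" for x using member_le_sum_list[OF that] h by simp
    show "x \<le> n" if "x \<in> set \<mu>" for x using member_le_sum_list[OF that] h by simp
  qed
  show "finite (?L \<times> ?L)" by (intro finite_cartesian_product finite_lists_length_le) auto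
qed

section \<open>Relabellings between monomials of equal type\<close>

lemma count_image_mset_inj_on:
  assumes "inj_on f (set_mset m)" "x \<in># m"
  shows "count (image_mset f m) (f x) = count m x"
proof -
  have "f -` {f x} \<inter> set_mset m = {x}" using assms by (auto simp: inj_on_def)
  then show ?thesis by (simp add: count_image_mset)
qed

lemma count_image_mset_inj:
  assumes "inj f" shows "count (image_mset f m) (f x) = count m x"
proof (cases "x \<in># m")
  case True
  then show ?thesis using assms by (intro count_image_mset_inj_on) (auto intro: inj_on_subset)
next
  case False
  then have "f x \<notin># image_mset f m" using assms by (auto dest: injD)
  then show ?thesis using False by (metis count_eq_zero_iff)
qed

text \<open>The \<open>i\<close>-th variable of \<open>m\<close> goes to the \<open>i\<close>-th
  variable of \<open>m'\<close>; this makes quasisymmetry a statement about relabelling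
  colours.\<close>

lemma comp_of_eq_imp_strict_mono:
  assumes "comp_of m = comp_of m'"
  obtains f where "strict_mono_on (set_mset m) f" "m' = image_mset f m"
proof -
  define l where "l = support_list m"
  define l' where "l' = support_list m'"
  define f where "f x = the (map_of (zip l l') x)" for x
  have len: "length l = length l'"
    using arg_cong[OF assms, of length] by (simp add: comp_of_def l_def l'_def)
  have l: "sorted_wrt (<) l" "sorted_wrt (<) l'" "distinct l" "distinct l'"
    "set l = set_mset m" "set l' = set_mset m'"
    by (simp_all add: l_def l'_def)
  have f: "f (l ! i) = l' ! i" if "i < length l" for i
    using that len l map_of_zip_nth[of l l' i] by (simp add: f_def)
  have mono: "strict_mono_on (set_mset m) f"
  proof (rule strict_mono_onI)
    fix x y assume "x \<in># m" "y \<in># m" "x < y"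
    then obtain i j where ij: "i < length l" "j < length l" "x = l ! i" "y = l ! j"
      by (metis l(5) in_set_conv_nth)
    have "i < j"
    proof (rule ccontr)
      assume "\<not> i < j"
      then have "l ! j \<le> l ! i" using l(1) ij by (metis linorder_neqE_nat order.refl less_imp_le sorted_wrt_nth_less)
      then show False using \<open>x < y\<close> ij by simp
    qed
    then show "f x < f y" using ij f len sorted_wrt_nth_less[OF l(2)] by simp
  qed
  have c: "count m (l ! i) = count m' (l' ! i)" if "i < length l" for i
    using assms that len by (metis comp_of_def l_def l'_def nth_map)
  have inj: "inj_on f (set_mset m)" using mono by (rule strict_mono_on_imp_inj_on)
  have fset: "set_mset m' = f ` set_mset m"
  proof -
    have "l' = map f l" using f len by (auto intro: nth_equalityI)
    then show ?thesis using l(5,6) by (metis set_map)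
  qed
  have "m' = image_mset f m"
  proof (rule multiset_eqI)
    fix y show "count m' y = count (image_mset f m) y"
    proof (cases "y \<in># m'")
      case True
      then obtain i where i: "i < length l" "y = l' ! i" by (metis l(6) len in_set_conv_nth)
      then have "l ! i \<in># m" using l(5) nth_mem by metis
      then show ?thesis using count_image_mset_inj_on[OF inj, of "l ! i"] f i c by simp
    next
      case False
      then show ?thesis using fset by (metis count_eq_zero_iff set_image_mset)
    qed
  qed
  with mono show thesis by (rule that)
qed

text \<open>A permutation of the union of the supports, rather than a bijection between them, can
  later be factored into transpositions.\<close>

lemma part_of_eq_imp_permutes:
  assumes "part_of m = part_of m'"
  obtains p where "p permutes (set_mset m \<union> set_mset m')" "m' = image_mset p m"
proof -
  let ?A = "set_mset m \<union> set_mset m'"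
  have eq: "image_mset (count m) (mset_set (set_mset m)) = image_mset (count m') (mset_set (set_mset m'))"
    by (metis assms mset_part_of mset_comp_of)
  \<comment> \<open>Extended by zero to the union, the two families of multiplicities stay equal as
    multisets, because both supports have the same size and so receive the same number of
    zeros.\<close>
  have pad: "image_mset (count k) (mset_set ?A)
      = image_mset (count k) (mset_set (set_mset k)) + replicate_mset (card ?A - card (set_mset k)) 0"
    if "set_mset k \<subseteq> ?A" for k
  proof -
    have "mset_set ?A = mset_set (set_mset k) + mset_set (?A - set_mset k)"
      using that by (metis Diff_disjoint Diff_partition finite_Diff finite_set_mset finite_Un mset_set_Union)
    moreover have "image_mset (count k) (mset_set (?A - set_mset k))
        = image_mset (\<lambda>_. 0) (mset_set (?A - set_mset k))"
      by (rule image_mset_cong) (auto simp: count_eq_zero_iff)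
    ultimately show ?thesis using that
      by (simp add: card_Diff_subset image_mset_const_eq)
  qed
  have "card (set_mset m) = card (set_mset m')"
    using arg_cong[OF eq, of size] by simp
  then have "image_mset (count m) (mset_set ?A) = image_mset (count m') (mset_set ?A)"
    using pad[of m] pad[of m'] eq by simp
  then obtain p where p: "p permutes ?A" "\<forall>x\<in>?A. count m x = count m' (p x)"
    using image_mset_eq_implies_permutes[of ?A "count m" "count m'"] by auto
  have c: "count m x = count m' (p x)" for x
    using p permutes_not_in[OF p(1), of x] by (cases "x \<in> ?A") (auto simp: not_in_iff)
  have "m' = image_mset p m"
  proof (rule multiset_eqI)
    fix y obtain x where y: "y = p x" using permutes_surj[OF p(1)] by (metis surjD)
    show "count m' y = count (image_mset p m) y"
      using c[of x] count_image_mset_inj[OF permutes_inj[OF p(1)], of m x] y by simp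
  qed
  with p(1) show thesis by (rule that)
qed

subsection \<open>Monomial series\<close>

definition Mtuples :: "nat list \<Rightarrow> nat list \<Rightarrow> nat multiset \<Rightarrow> nat list set" where
  "Mtuples \<beta> \<mu> m = {is. length is = length \<beta> + length \<mu> \<and> distinct is \<and> (\<forall>i\<in>set is. i > 0) \<and>
      sorted_wrt (<) (take (length \<beta>) is) \<and>
      (\<Sum>j<length is. replicate_mset ((\<beta> @ \<mu>) ! j) (is ! j)) = m}"

text \<open>The free part of a tuple counted by \<open>Mser\<close>: the orders of the small
  variables in which their multiplicities read \<open>\<mu>\<close>.\<close>

definition fillings :: "nat list \<Rightarrow> nat multiset \<Rightarrow> nat list set" where
  "fillings \<mu> m = {ys. distinct ys \<and> set ys = set_mset m \<and> map (count m) ys = \<mu>}"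

lemma Mser_eq: "Mser (\<beta>, \<mu>) m = of_nat (card (Mtuples \<beta> \<mu> m))"
  by (simp add: Mser_def Mtuples_def)

text \<open>Positive exponents make every listed index occur, so the product of powers determines
  support and exponents.\<close>

lemma sum_replicate_mset_eq_iff:
  assumes "distinct is" "length xs = length is" "\<forall>x\<in>set xs. 0 < x"
  shows "(\<Sum>j<length is. replicate_mset (xs ! j) (is ! j)) = m
    \<longleftrightarrow> set is = set_mset m \<and> map (count m) is = xs" (is "?s = m \<longleftrightarrow> _")
proof -
  have c: "count ?s (is ! i) = xs ! i" if "i < length is" for i
  proof -
    have "count ?s (is ! i) = (\<Sum>j<length is. if j = i then xs ! j else 0)"
      unfolding count_sum by (rule sum.cong) (use assms that in \<open>auto simp: nth_eq_iff_index_eq\<close>)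
    then show ?thesis using that by simp
  qed
  have z: "count ?s x = 0" if "x \<notin> set is" for x
    unfolding count_sum by (rule sum.neutral) (use that in auto)
  have s: "set_mset ?s = set is"
  proof (intro set_eqI iffI)
    fix x assume "x \<in># ?s" then show "x \<in> set is" using z[of x] by (metis count_eq_zero_iff)
  next
    fix x assume "x \<in> set is"
    then obtain i where "i < length is" "x = is ! i" by (metis in_set_conv_nth)
    then show "x \<in># ?s" using c[of i] assms(2,3) nth_mem[of i xs] by (metis count_inI less_numeral_extra(3))
  qed
  show ?thesis
  proof
    assume "?s = m"
    then show "set is = set_mset m \<and> map (count m) is = xs"
      using s c assms(2) by (auto intro!: nth_equalityI)
  next
    assume r: "set is = set_mset m \<and> map (count m) is = xs"
    show "?s = m"
    proof (rule multiset_eqI)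
      fix x show "count ?s x = count m x"
      proof (cases "x \<in> set is")
        case True
        then obtain i where "i < length is" "x = is ! i" by (metis in_set_conv_nth)
        then show ?thesis using c r by auto
      next
        case False
        moreover have "count m x = 0" using False r by (simp add: count_eq_zero_iff)
        ultimately show ?thesis using z by simp
      qed
    qed
  qed
qed

lemma rcompsD:
  assumes "(\<beta>, \<mu>) \<in> rcomps r n"
  shows "\<forall>x\<in>set \<beta>. 0 < x" "\<forall>x\<in>set \<beta>. r \<le> enat x" "is_partition \<mu>" "\<forall>x\<in>set \<mu>. 0 < x"
    "\<forall>x\<in>set \<mu>. enat x < r" "sum_list \<beta> + sum_list \<mu> = n"
  using assms by (auto simp: rcomps_def is_partition_def)

lemma Mtuples_iff:
  assumes "(\<beta>, \<mu>) \<in> rcomps r n"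
  shows "is \<in> Mtuples \<beta> \<mu> m \<longleftrightarrow> distinct is \<and> (\<forall>i\<in>set is. 0 < i) \<and>
    sorted_wrt (<) (take (length \<beta>) is) \<and> set is = set_mset m \<and> map (count m) is = \<beta> @ \<mu>"
proof -
  have "\<forall>x\<in>set (\<beta> @ \<mu>). 0 < x" using rcompsD[OF assms] by auto
  note e = sum_replicate_mset_eq_iff[OF _ _ this, of "is" m]
  have "length is = length \<beta> + length \<mu>" if "map (count m) is = \<beta> @ \<mu>"
    using arg_cong[OF that, of length] by simp
  then show ?thesis unfolding Mtuples_def mem_Collect_eq using e by (metis length_append)
qed

text \<open>Comparison with \<open>r\<close> tells which variables fill the first
  \<open>length \<beta>\<close> places, and being increasing fixes their order; only the order of
  the small variables is free.\<close>

lemma Mtuples_eq: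
  assumes "(\<beta>, \<mu>) \<in> rcomps r n"
  shows "Mtuples \<beta> \<mu> m = (if comp_of (big r m) = \<beta> \<and> 0 \<notin># m
    then (\<lambda>ys. support_list (big r m) @ ys) ` fillings \<mu> (small r m) else {})" (is "_ = ?R")
proof (intro set_eqI iffI)
  fix xs assume "xs \<in> Mtuples \<beta> \<mu> m"
  then have xs: "distinct xs" "\<forall>i\<in>set xs. 0 < i" "sorted_wrt (<) (take (length \<beta>) xs)"
    "set xs = set_mset m" "map (count m) xs = \<beta> @ \<mu>"
    using Mtuples_iff[OF assms] by auto
  define us ys where "us = take (length \<beta>) xs" and "ys = drop (length \<beta>) xs"
  have u: "xs = us @ ys" "map (count m) us = \<beta>" "map (count m) ys = \<mu>"
    using xs(5) by (auto simp: us_def ys_def take_map[symmetric] drop_map[symmetric])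
  have "\<forall>x\<in>set us. r \<le> enat (count m x)" "\<forall>x\<in>set ys. enat (count m x) < r"
    using rcompsD(2,5)[OF assms] u(2,3) by auto
  then have s: "set us = set_mset (big r m)" "set ys = set_mset (small r m)"
    using xs(4) u(1) unfolding set_big set_small not_le[symmetric] by auto
  have us: "us = support_list (big r m)"
    using xs(3) s(1) sorted_list_of_set.idem_if_sorted_distinct[of us]
    by (simp add: us_def[symmetric] strict_sorted_iff)
  have "map (count (big r m)) us = \<beta>" "map (count (small r m)) ys = \<mu>"
    using u(2,3) s by (auto simp: count_big count_small cong: map_cong)
  then show "xs \<in> ?R"
    using xs u(1) us s by (auto simp: comp_of_def fillings_def)
next
  fix xs assume xs: "xs \<in> ?R"
  then obtain ys where ys: "xs = support_list (big r m) @ ys" "ys \<in> fillings \<mu> (small r m)"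
    and c: "comp_of (big r m) = \<beta>" "0 \<notin># m"
    by (auto split: if_splits)
  have m: "set_mset m = set_mset (big r m) \<union> set_mset (small r m)"
    by (metis big_plus_small set_mset_union)
  then have s: "set xs = set_mset m" using ys by (simp add: fillings_def)
  have "map (count m) (support_list (big r m)) = map (count (big r m)) (support_list (big r m))"
    by (intro map_cong) (auto simp: count_big)
  then have "map (count m) (support_list (big r m)) = \<beta>" using c(1)
    unfolding comp_of_def by (rule trans)
  moreover have "map (count m) ys = map (count (small r m)) ys"
    using ys(2) by (intro map_cong) (auto simp: fillings_def count_small)
  then have "map (count m) ys = \<mu>" using ys(2) unfolding fillings_def mem_Collect_eq by metis
  ultimately have cnt: "map (count m) xs = \<beta> @ \<mu>" by (simp add: ys(1))
  have len: "length \<beta> = length (support_list (big r m))" using c(1) by (auto simp: comp_of_def)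
  show "xs \<in> Mtuples \<beta> \<mu> m" unfolding Mtuples_iff[OF assms]
  proof (intro conjI)
    show "distinct xs" using ys by (auto simp: fillings_def set_big set_small)
    show "\<forall>i\<in>set xs. 0 < i" using s c(2) by (metis gr0I)
    show "sorted_wrt (<) (take (length \<beta>) xs)" using ys len by simp
  qed (use s cnt in auto)
qed

lemma Mser_eq_fillings:
  assumes "(\<beta>, \<mu>) \<in> rcomps r n"
  shows "Mser (\<beta>, \<mu>) m = (if comp_of (big r m) = \<beta> \<and> 0 \<notin># m
    then of_nat (card (fillings \<mu> (small r m))) else 0)"
  by (auto simp: Mser_eq Mtuples_eq[OF assms] intro!: card_image inj_onI)

lemma finite_fillings: "finite (fillings \<mu> m)"
  by (rule finite_subset[OF _ finite_subset_distinct[of "set_mset m"]]) (auto simp: fillings_def)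

lemma part_of_filling:
  assumes "is_partition \<mu>" "ys \<in> fillings \<mu> m" shows "part_of m = \<mu>"
proof (rule part_of_eqI[OF assms(1)])
  have "mset ys = mset_set (set_mset m)"
    using assms(2) mset_set_set[of ys] by (auto simp: fillings_def)
  then show "mset \<mu> = mset (comp_of m)"
    using assms(2) by (auto simp: fillings_def mset_comp_of)
qed

lemma ex_filling: "\<exists>ys. ys \<in> fillings (part_of m) m"
proof
  let ?ys = "rev (sort_key (count m) (support_list m))"
  have "map (count m) (sort_key (count m) (support_list m)) = sort (comp_of m)"
    by (rule properties_for_sort[symmetric]) (simp_all add: comp_of_def)
  then show "?ys \<in> fillings (part_of m) m"
    by (simp add: fillings_def part_of_def rev_map[symmetric])
qed

text \<open>A permutation carrying \<open>m\<close> to \<open>m'\<close> maps fillings injectively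
  to fillings, and the roles of \<open>m\<close> and \<open>m'\<close> are symmetric.\<close>

lemma card_fillings_cong:
  assumes "part_of m = part_of m'" shows "card (fillings \<mu> m) = card (fillings \<mu> m')"
proof -
  have le: "card (fillings \<mu> m) \<le> card (fillings \<mu> m')" if eq: "part_of m = part_of m'" for m m'
  proof -
    obtain p where p: "p permutes (set_mset m \<union> set_mset m')" "m' = image_mset p m"
      using part_of_eq_imp_permutes[OF eq] .
    have inj: "inj p" using p(1) by (rule permutes_inj)
    have "map p ys \<in> fillings \<mu> m'" if "ys \<in> fillings \<mu> m" for ys
      using that inj_on_subset[OF inj subset_UNIV] count_image_mset_inj_on[of p m]
      unfolding p(2) fillings_def by (auto simp: distinct_map)
    then show ?thesis
      using inj finite_fillings by (intro card_inj_on_le[of "map p"]) (auto intro: inj_on_subset[OF inj_mapI])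
  qed
  show ?thesis using le[OF assms] le[OF assms[symmetric]] by simp
qed

lemma ex_good_rtype:
  assumes "bm \<in> rcomps r n" shows "\<exists>m. good n m \<and> rtype r m = bm"
proof -
  obtain \<beta> \<mu> where bm: "bm = (\<beta>, \<mu>)" by force
  note h = assms[unfolded bm]
  \<comment> \<open>The variables with indices 1, 2, ... receive the parts in order; the type of the
    resulting \<open>m\<close> is then read off from the fact that \<open>xs\<close> itself is one
    of its tuples.\<close>
  define xs where "xs = [1..<Suc (length \<beta> + length \<mu>)]"
  define m where "m = (\<Sum>j<length xs. replicate_mset ((\<beta> @ \<mu>) ! j) (xs ! j))"
  have "xs \<in> Mtuples \<beta> \<mu> m"
    unfolding Mtuples_def mem_Collect_eq
    by (intro conjI sorted_wrt_take) (auto simp: m_def xs_def simp del: upt_Suc)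
  then obtain ys where "comp_of (big r m) = \<beta>" "0 \<notin># m" "ys \<in> fillings \<mu> (small r m)"
    unfolding Mtuples_eq[OF h] by (auto split: if_splits)
  then have t: "rtype r m = bm" "0 \<notin># m"
    using part_of_filling[OF rcompsD(3)[OF h]] by (auto simp: rtype_def bm)
  moreover have "size m = n"
  proof -
    have "size m = size (big r m) + size (small r m)" by (metis big_plus_small size_union)
    also have "\<dots> = sum_list \<beta> + sum_list \<mu>"
      using t(1) by (auto simp: rtype_def bm sum_comp_of sum_part_of)
    finally show ?thesis using rcompsD(6)[OF h] by simp
  qed
  ultimately show ?thesis by (auto simp: good_def)
qed

lemma sum_list_rtype: "sum_list (fst (rtype r m)) + sum_list (snd (rtype r m)) = size m"
  by (simp add: rtype_def sum_comp_of sum_part_of flip: size_union) (simp add: big_plus_small)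

lemma Mser_nonzero_iff:
  assumes "bm \<in> rcomps r n"
  shows "Mser bm m \<noteq> 0 \<longleftrightarrow> 0 \<notin># m \<and> rtype r m = bm"
proof -
  obtain \<beta> \<mu> where bm: "bm = (\<beta>, \<mu>)" by force
  note h = assms[unfolded bm]
  have "fillings \<mu> (small r m) \<noteq> {} \<longleftrightarrow> part_of (small r m) = \<mu>"
    using part_of_filling[OF rcompsD(3)[OF h]] ex_filling[of "small r m"] by blast
  then have "card (fillings \<mu> (small r m)) \<noteq> 0 \<longleftrightarrow> part_of (small r m) = \<mu>"
    by (simp add: card_eq_0_iff finite_fillings)
  then show ?thesis by (auto simp: Mser_eq_fillings[OF h] bm rtype_def)
qed

text \<open>A constant rank suffices, since each series lives on a single type.\<close>

lemma Mser_triangular: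
  "triangular_family (good n) (rtype r) (rcomps r n) Mser (\<lambda>_. 0)"
proof
  fix bm assume bm: "bm \<in> rcomps r n"
  show "Mser bm \<in> class_series (good n) (rtype r)"
  proof (rule class_seriesI)
    show "Mser bm m = 0" if "\<not> good n m" for m
    proof (rule ccontr)
      assume "Mser bm m \<noteq> 0"
      then have "0 \<notin># m" "rtype r m = bm" using Mser_nonzero_iff[OF bm] by auto
      then show False using that bm sum_list_rtype[of r m] by (auto simp: good_def rcomps_def)
    qed
    show "Mser bm m = Mser bm m'" if "good n m" "good n m'" "rtype r m = rtype r m'" for m m'
      using that bm card_fillings_cong[of "small r m" "small r m'" "snd bm"]
        Mser_eq_fillings[of "fst bm" "snd bm" r n]
      by (auto simp: rtype_def good_def)
  qed
next
  show "Mser (rtype r m) m \<noteq> 0" if "good n m" for m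
    using Mser_nonzero_iff[OF rtype_in_rcomps[OF that]] that by (auto simp: good_def)
qed (use Mser_nonzero_iff in \<open>auto simp: finite_rcomps rtype_in_rcomps ex_good_rtype\<close>)

text \<open>The first basis identifies the span that defines \<open>QSym\<close>; the other families
  need only be compared with class functions.\<close>

lemma QSym_eq_class_series: "QSym r n = class_series (good n) (rtype r)"
  using triangular_family.basis[OF Mser_triangular] by (simp add: QSym_def is_basis_family_def)

subsection \<open>Colourings\<close>

definition colourings :: "egraph \<Rightarrow> nat multiset \<Rightarrow> (nat list \<Rightarrow> nat) set" where
  "colourings G m = {\<kappa>. proper_colouring G \<kappa> \<and> image_mset \<kappa> (mset_set (fst G)) = m}"

lemma chromX_eq: "chromX G m = of_nat (card (colourings G m))"
  by (simp add: chromX_def colourings_def)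

lemma colouringsD:
  assumes "\<kappa> \<in> colourings G m"
  shows "\<kappa> \<in> extensional (fst G)" "\<And>v. v \<in> fst G \<Longrightarrow> 0 < \<kappa> v"
    "image_mset \<kappa> (mset_set (fst G)) = m"
  using assms by (auto simp: colourings_def proper_colouring_def PiE_iff Suc_le_eq)

lemma colourings_edge:
  assumes "\<kappa> \<in> colourings G m" "a \<in> fst G" "b \<in> fst G" "snd G a b = Some k"
  shows "edge_ok k (\<kappa> a) (\<kappa> b)"
  using assms by (fastforce simp: colourings_def proper_colouring_def)

lemma colouringsI:
  assumes "\<kappa> \<in> extensional (fst G)" "\<And>v. v \<in> fst G \<Longrightarrow> 0 < \<kappa> v"
    "\<And>a b k. a \<in> fst G \<Longrightarrow> b \<in> fst G \<Longrightarrow> snd G a b = Some k \<Longrightarrow> edge_ok k (\<kappa> a) (\<kappa> b)"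
    "image_mset \<kappa> (mset_set (fst G)) = m"
  shows "\<kappa> \<in> colourings G m"
  using assms by (auto simp: colourings_def proper_colouring_def PiE_iff Suc_le_eq split: option.split)

lemma colourings_set:
  assumes "finite (fst G)" "\<kappa> \<in> colourings G m" shows "set_mset m = \<kappa> ` fst G"
  using colouringsD(3)[OF assms(2)] assms(1) by auto

lemma colourings_size:
  assumes "\<kappa> \<in> colourings G m" shows "size m = card (fst G)"
  using colouringsD(3)[OF assms] by auto

lemma colourings_zero:
  assumes "finite (fst G)" "\<kappa> \<in> colourings G m" shows "0 \<notin># m"
  using colourings_set[OF assms] colouringsD(2)[OF assms(2)] by (metis imageE less_irrefl)

lemma finite_colourings:
  assumes "finite (fst G)" shows "finite (colourings G m)"
proof (rule finite_subset)
  show "colourings G m \<subseteq> fst G \<rightarrow>\<^sub>E set_mset m"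
  proof
    fix \<kappa> assume k: "\<kappa> \<in> colourings G m"
    show "\<kappa> \<in> fst G \<rightarrow>\<^sub>E set_mset m"
      unfolding PiE_iff colourings_set[OF assms k] using colouringsD(1)[OF k] by blast
  qed
qed (use assms in \<open>simp add: finite_PiE\<close>)

lemma chromX_nonzero_iff:
  assumes "finite (fst G)" shows "chromX G m \<noteq> 0 \<longleftrightarrow> colourings G m \<noteq> {}"
  using finite_colourings[OF assms] by (simp add: chromX_eq)

text \<open>Composing colourings with \<open>f\<close> is injective; only the edge conditions depend
  on the kind of relabelling. It serves increasing maps for quasisymmetry and permutations for
  dashed sums of cycles.\<close>

lemma card_colourings_relabel_le:
  assumes "finite (fst G)" "inj_on f (set_mset m)" "\<And>x. x \<in># m \<Longrightarrow> 0 < f x"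
    and edge: "\<And>\<kappa> a b k. \<kappa> \<in> colourings G m \<Longrightarrow> a \<in> fst G \<Longrightarrow> b \<in> fst G \<Longrightarrow> snd G a b = Some k \<Longrightarrow>
      edge_ok k (f (\<kappa> a)) (f (\<kappa> b))"
  shows "card (colourings G m) \<le> card (colourings G (image_mset f m))"
proof (rule card_inj_on_le)
  let ?F = "\<lambda>\<kappa>. restrict (\<lambda>v. f (\<kappa> v)) (fst G)"
  note set = colourings_set[OF assms(1)]
  show "inj_on ?F (colourings G m)"
  proof (rule inj_onI)
    fix \<kappa> \<kappa>' assume k: "\<kappa> \<in> colourings G m" "\<kappa>' \<in> colourings G m" "?F \<kappa> = ?F \<kappa>'"
    have "\<kappa> v = \<kappa>' v" if "v \<in> fst G" for v
      using inj_onD[OF assms(2), of "\<kappa> v" "\<kappa>' v"] set[OF k(1)] set[OF k(2)] fun_cong[OF k(3), of v] that by auto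
    then show "\<kappa> = \<kappa>'" using colouringsD(1)[OF k(1)] colouringsD(1)[OF k(2)] by (intro extensionalityI)
  qed
  show "?F ` colourings G m \<subseteq> colourings G (image_mset f m)"
  proof safe
    fix \<kappa> assume k: "\<kappa> \<in> colourings G m"
    show "?F \<kappa> \<in> colourings G (image_mset f m)"
    proof (rule colouringsI)
      show "0 < ?F \<kappa> v" if "v \<in> fst G" for v using that assms(3) set[OF k] by simp
      show "edge_ok e (?F \<kappa> a) (?F \<kappa> b)" if "a \<in> fst G" "b \<in> fst G" "snd G a b = Some e" for a b e
        using that edge[OF k that] by simp
      have "image_mset (?F \<kappa>) (mset_set (fst G)) = image_mset (\<lambda>v. f (\<kappa> v)) (mset_set (fst G))"
        by (rule image_mset_cong) (use assms(1) in auto)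
      then show "image_mset (?F \<kappa>) (mset_set (fst G)) = image_mset f m"
        using colouringsD(3)[OF k] by (auto simp: image_mset.compositionality comp_def)
    qed simp
  qed
qed (use finite_colourings[OF assms(1)] in simp)

lemma edge_ok_strict_mono:
  "strict_mono_on A f \<Longrightarrow> x \<in> A \<Longrightarrow> y \<in> A \<Longrightarrow> edge_ok k x y \<Longrightarrow> edge_ok k (f x) (f y)"
  by (cases k) (auto dest: strict_mono_onD strict_mono_on_leD strict_mono_on_eqD)

text \<open>Strictly increasing relabelling preserves all three edge conditions, and it is available
  in both directions.\<close>

lemma chromX_quasisymmetric:
  assumes "finite (fst G)" "comp_of m = comp_of m'" "0 \<notin># m" "0 \<notin># m'"
  shows "chromX G m = chromX G m'"
proof -
  have "card (colourings G m) \<le> card (colourings G m')"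
    if eq: "comp_of m = comp_of m'" and "0 \<notin># m'" for m m'
  proof -
    obtain f where f: "strict_mono_on (set_mset m) f" "m' = image_mset f m"
      using comp_of_eq_imp_strict_mono[OF eq] .
    show ?thesis unfolding f(2)
    proof (rule card_colourings_relabel_le[OF assms(1) strict_mono_on_imp_inj_on[OF f(1)]])
      show "0 < f x" if "x \<in># m" for x using that \<open>0 \<notin># m'\<close> f(2) by (metis gr0I image_eqI set_image_mset)
      show "edge_ok e (f (\<kappa> a)) (f (\<kappa> b))"
        if k: "\<kappa> \<in> colourings G m" and "a \<in> fst G" "b \<in> fst G" "snd G a b = Some e" for \<kappa> a b e
        using that colourings_set[OF assms(1) k] colourings_edge[OF that]
        by (intro edge_ok_strict_mono[OF f(1)]) auto
    qed
  qed
  then show ?thesis using assms(2-4) by (simp add: chromX_eq le_antisym)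
qed

text \<open>Invariance under permutations of the variables, phrased through sorted exponents; the
  index 0 is excluded because it is not a variable.\<close>

definition symmetric_series :: "series \<Rightarrow> bool" where
  "symmetric_series f \<longleftrightarrow>
     (\<forall>m m'. 0 \<notin># m \<longrightarrow> 0 \<notin># m' \<longrightarrow> part_of m = part_of m' \<longrightarrow> f m = f m')"

lemma symmetric_seriesD:
  "symmetric_series f \<Longrightarrow> 0 \<notin># m \<Longrightarrow> 0 \<notin># m' \<Longrightarrow> part_of m = part_of m' \<Longrightarrow> f m = f m'"
  unfolding symmetric_series_def by blast

section \<open>Colourings of a sum of two graphs\<close>

lemma fst_gsum: "fst (gsum k G1 G2) = (#) 0 ` fst G1 \<union> (#) (Suc 0) ` fst G2"
  and snd_gsum: "snd (gsum k G1 G2) = gsum_edges k G1 G2"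
  by (simp_all add: gsum_def)

lemma finite_gsum: "finite (fst G1) \<Longrightarrow> finite (fst G2) \<Longrightarrow> finite (fst (gsum k G1 G2))"
  by (simp add: fst_gsum)

definition glue :: "egraph \<Rightarrow> egraph \<Rightarrow> (nat list \<Rightarrow> nat) \<Rightarrow> (nat list \<Rightarrow> nat) \<Rightarrow> nat list \<Rightarrow> nat" where
  "glue G1 G2 \<kappa>1 \<kappa>2 = (\<lambda>v\<in>(#) 0 ` fst G1 \<union> (#) (Suc 0) ` fst G2. if hd v = 0 then \<kappa>1 (tl v) else \<kappa>2 (tl v))"

lemma glue_simps:
  "v \<in> fst G1 \<Longrightarrow> glue G1 G2 \<kappa>1 \<kappa>2 (0 # v) = \<kappa>1 v"
  "v \<in> fst G2 \<Longrightarrow> glue G1 G2 \<kappa>1 \<kappa>2 (Suc 0 # v) = \<kappa>2 v"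
  by (auto simp: glue_def)

lemma image_mset_gsum:
  assumes "finite (fst G1)" "finite (fst G2)"
  shows "image_mset \<kappa> (mset_set (fst (gsum k G1 G2)))
    = image_mset (\<lambda>v. \<kappa> (0 # v)) (mset_set (fst G1)) + image_mset (\<lambda>v. \<kappa> (Suc 0 # v)) (mset_set (fst G2))"
proof -
  have "mset_set (fst (gsum k G1 G2)) = mset_set ((#) 0 ` fst G1) + mset_set ((#) (Suc 0) ` fst G2)"
    unfolding fst_gsum by (rule mset_set_Union) (use assms in auto)
  then show ?thesis
    using assms by (simp add: image_mset_mset_set[symmetric] image_mset.compositionality comp_def)
qed

lemma colourings_gsum_left:
  assumes fin: "finite (fst G1)" "finite (fst G2)" and k: "\<kappa> \<in> colourings (gsum k G1 G2) m"
  shows "restrict (\<lambda>v. \<kappa> (0 # v)) (fst G1) \<in> colourings G1 (image_mset (\<lambda>v. \<kappa> (0 # v)) (mset_set (fst G1)))"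
    (is "?r \<in> _")
proof (rule colouringsI)
  show "0 < ?r v" if "v \<in> fst G1" for v
    using that colouringsD(2)[OF k, of "0 # v"] by (auto simp: fst_gsum)
  show "edge_ok q (?r a) (?r b)" if "a \<in> fst G1" "b \<in> fst G1" "snd G1 a b = Some q" for a b q
    using that colourings_edge[OF k, of "0 # a" "0 # b" q] by (auto simp: fst_gsum snd_gsum)
qed (auto intro!: image_mset_cong simp: fin)

lemma colourings_gsum_right:
  assumes fin: "finite (fst G1)" "finite (fst G2)" and k: "\<kappa> \<in> colourings (gsum k G1 G2) m"
  shows "restrict (\<lambda>v. \<kappa> (Suc 0 # v)) (fst G2)
    \<in> colourings G2 (image_mset (\<lambda>v. \<kappa> (Suc 0 # v)) (mset_set (fst G2)))" (is "?r \<in> _")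
proof (rule colouringsI)
  show "0 < ?r v" if "v \<in> fst G2" for v
    using that colouringsD(2)[OF k, of "Suc 0 # v"] by (auto simp: fst_gsum)
  show "edge_ok q (?r a) (?r b)" if "a \<in> fst G2" "b \<in> fst G2" "snd G2 a b = Some q" for a b q
    using that colourings_edge[OF k, of "Suc 0 # a" "Suc 0 # b" q] by (auto simp: fst_gsum snd_gsum)
qed (auto intro!: image_mset_cong simp: fin)

text \<open>Cross edges join every vertex of \<open>G1\<close> to every vertex of \<open>G2\<close>,
  so their condition depends on the two colourings only through the colour multisets
  \<open>m1\<close> and \<open>m2\<close>.\<close>

lemma bij_betw_colourings_gsum:
  assumes fin: "finite (fst G1)" "finite (fst G2)"
  shows "bij_betw (\<lambda>(\<kappa>1, \<kappa>2). glue G1 G2 \<kappa>1 \<kappa>2)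
    (\<Union>(m1, m2)\<in>{(m1, m2). m1 + m2 = m \<and> (\<forall>x\<in>#m1. \<forall>y\<in>#m2. edge_ok k x y)}. colourings G1 m1 \<times> colourings G2 m2)
    (colourings (gsum k G1 G2) m)" (is "bij_betw ?g ?A ?B")
proof (rule bij_betw_byWitness)
  let ?h = "\<lambda>\<kappa>. (restrict (\<lambda>v. \<kappa> (0 # v)) (fst G1), restrict (\<lambda>v. \<kappa> (Suc 0 # v)) (fst G2))"
  show "\<forall>p\<in>?A. ?h (?g p) = p"
    by (auto simp: glue_simps fun_eq_iff dest!: colouringsD(1) simp: extensional_def restrict_def)
  show "\<forall>\<kappa>\<in>?B. ?g (?h \<kappa>) = \<kappa>"
  proof
    fix \<kappa> assume "\<kappa> \<in> ?B"
    then have "\<kappa> \<in> extensional (fst (gsum k G1 G2))" by (rule colouringsD(1))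
    then show "?g (?h \<kappa>) = \<kappa>"
      by (intro extensionalityI[of _ "fst (gsum k G1 G2)"]) (auto simp: glue_def fst_gsum)
  qed
  show "?g ` ?A \<subseteq> ?B"
  proof safe
    fix \<kappa>1 \<kappa>2 m1 m2
    assume e: "\<forall>x\<in>#m1. \<forall>y\<in>#m2. edge_ok k x y"
      and k1: "\<kappa>1 \<in> colourings G1 m1" and k2: "\<kappa>2 \<in> colourings G2 m2"
    let ?K = "glue G1 G2 \<kappa>1 \<kappa>2"
    show "?K \<in> colourings (gsum k G1 G2) (m1 + m2)"
    proof (rule colouringsI)
      show "?K \<in> extensional (fst (gsum k G1 G2))" by (simp add: glue_def fst_gsum)
      show "0 < ?K v" if "v \<in> fst (gsum k G1 G2)" for v
        using that colouringsD(2)[OF k1] colouringsD(2)[OF k2] by (auto simp: fst_gsum glue_simps)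
      show "edge_ok q (?K a) (?K b)" if "a \<in> fst (gsum k G1 G2)" "b \<in> fst (gsum k G1 G2)"
        "snd (gsum k G1 G2) a b = Some q" for a b q
        using that colourings_edge[OF k1] colourings_edge[OF k2] e
          colourings_set[OF fin(1) k1] colourings_set[OF fin(2) k2]
        by (auto simp: fst_gsum snd_gsum glue_simps)
      have "image_mset (\<lambda>v. ?K (0 # v)) (mset_set (fst G1)) = image_mset \<kappa>1 (mset_set (fst G1))"
        "image_mset (\<lambda>v. ?K (Suc 0 # v)) (mset_set (fst G2)) = image_mset \<kappa>2 (mset_set (fst G2))"
        by (auto intro!: image_mset_cong simp: glue_simps fin)
      then show "image_mset ?K (mset_set (fst (gsum k G1 G2))) = m1 + m2"
        by (simp add: image_mset_gsum[OF fin] colouringsD(3)[OF k1] colouringsD(3)[OF k2])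
    qed
  qed
  show "?h ` ?B \<subseteq> ?A"
  proof
    fix p assume "p \<in> ?h ` ?B"
    then obtain \<kappa> where k: "\<kappa> \<in> ?B" and p: "p = ?h \<kappa>" by blast
    let ?m1 = "image_mset (\<lambda>v. \<kappa> (0 # v)) (mset_set (fst G1))"
    let ?m2 = "image_mset (\<lambda>v. \<kappa> (Suc 0 # v)) (mset_set (fst G2))"
    have "fst p \<in> colourings G1 ?m1" "snd p \<in> colourings G2 ?m2"
      using colourings_gsum_left[OF fin k] colourings_gsum_right[OF fin k] by (simp_all add: p)
    moreover have "?m1 + ?m2 = m" using colouringsD(3)[OF k] image_mset_gsum[OF fin, of \<kappa> k] by simp
    moreover have "edge_ok k x y" if "x \<in># ?m1" "y \<in># ?m2" for x y
    proof -
      from that obtain a b where "a \<in> fst G1" "x = \<kappa> (0 # a)" "b \<in> fst G2" "y = \<kappa> (Suc 0 # b)"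
        using fin by auto
      then show ?thesis using colourings_edge[OF k, of "0 # a" "Suc 0 # b" k] by (auto simp: fst_gsum snd_gsum)
    qed
    ultimately show "p \<in> ?A"
      by (intro UN_I[of "(?m1, ?m2)"]) (auto simp: mem_Times_iff)
  qed
qed

lemma colourings_gsum_nonempty_iff:
  assumes "finite (fst G1)" "finite (fst G2)"
  shows "colourings (gsum k G1 G2) m \<noteq> {} \<longleftrightarrow>
    (\<exists>m1 m2. m = m1 + m2 \<and> colourings G1 m1 \<noteq> {} \<and> colourings G2 m2 \<noteq> {} \<and>
      (\<forall>x\<in>#m1. \<forall>y\<in>#m2. edge_ok k x y))"
  using bij_betw_colourings_gsum[OF assms, of m k]
  unfolding bij_betw_def by (auto 4 4)

text \<open>Dashed cross edges demand disjoint colour sets, and then the thresholds force the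
  splitting of \<open>m\<close> by \<open>big_small_unique\<close>.\<close>

lemma chromX_dashed_gsum:
  assumes fin: "finite (fst G1)" "finite (fst G2)"
    and large: "\<And>m x. colourings G1 m \<noteq> {} \<Longrightarrow> x \<in># m \<Longrightarrow> r \<le> enat (count m x)"
    and less: "\<And>m x. colourings G2 m \<noteq> {} \<Longrightarrow> x \<in># m \<Longrightarrow> enat (count m x) < r"
  shows "chromX (gsum Dashed G1 G2) m = chromX G1 (big r m) * chromX G2 (small r m)"
proof -
  let ?S = "{(m1, m2). m1 + m2 = m \<and> (\<forall>x\<in>#m1. \<forall>y\<in>#m2. edge_ok Dashed x y)}"
  have "(\<Union>(m1, m2)\<in>?S. colourings G1 m1 \<times> colourings G2 m2)
    = colourings G1 (big r m) \<times> colourings G2 (small r m)" (is "?U = ?V")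
  proof
    show "?U \<subseteq> ?V"
    proof safe
      fix \<kappa>1 \<kappa>2 m1 m2 assume m: "\<forall>x\<in>#m1. \<forall>y\<in>#m2. edge_ok Dashed x y" "m = m1 + m2"
        and k: "\<kappa>1 \<in> colourings G1 m1" "\<kappa>2 \<in> colourings G2 m2"
      have "m1 = big r (m1 + m2)" "m2 = small r (m1 + m2)"
        using k m by (auto intro!: big_small_unique[OF refl] large less)
      with k show "\<kappa>1 \<in> colourings G1 (big r (m1 + m2))" "\<kappa>2 \<in> colourings G2 (small r (m1 + m2))"
        by simp_all
    qed
    \<comment> \<open>Conversely, any two colourings of these parts fit together, as their supports
      are disjoint.\<close>
    have "(big r m, small r m) \<in> ?S"
      by (auto simp: big_plus_small set_big set_small)
    then show "?V \<subseteq> ?U" by blast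
  qed
  then have "card (colourings (gsum Dashed G1 G2) m) = card (colourings G1 (big r m) \<times> colourings G2 (small r m))"
    using bij_betw_same_card[OF bij_betw_colourings_gsum[OF fin, of m Dashed]] by simp
  then show ?thesis by (simp add: chromX_eq card_cartesian_product)
qed

subsection \<open>Sums of cycles\<close>

lemma fst_cycleC: "fst (cycleC b) = (\<lambda>i. [i]) ` {..<b}"
  by (auto simp: cycleC_def)

lemma finite_cycleC: "finite (fst (cycleC b))"
  by (simp add: fst_cycleC)

lemma card_cycleC: "card (fst (cycleC b)) = b"
  by (simp add: fst_cycleC card_image inj_on_def)

text \<open>Colours increase weakly along the double edges, and going once around the cycle forces
  equality.\<close>

lemma cycleC_colouring_const:
  assumes "\<kappa> \<in> colourings (cycleC b) m" "i < b"
  shows "\<kappa> [i] = \<kappa> [0]"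
proof -
  have succ: "\<kappa> [j] \<le> \<kappa> [Suc j mod b]" if "j < b" for j
  proof (cases "b \<ge> 2")
    case True
    then show ?thesis using that colourings_edge[OF assms(1), of "[j]" "[Suc j mod b]" Double]
      by (auto simp: cycleC_def)
  next
    case False
    then show ?thesis using that by (cases "b = 1") auto
  qed
  have "i \<le> j \<Longrightarrow> j < b \<Longrightarrow> \<kappa> [i] \<le> \<kappa> [j]" for i j
  proof (induction j rule: dec_induct)
    case (step j)
    then show ?case using succ[of j] by simp
  qed simp
  then have "\<kappa> [0] \<le> \<kappa> [i]" "\<kappa> [i] \<le> \<kappa> [b - 1]" using assms(2) by auto
  moreover have "\<kappa> [b - 1] \<le> \<kappa> [0]" using succ[of "b - 1"] assms(2) by simp
  ultimately show ?thesis by simp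
qed

lemma colourings_cycleC_nonempty_iff:
  assumes "0 < b"
  shows "colourings (cycleC b) m \<noteq> {} \<longleftrightarrow> (\<exists>x>0. m = replicate_mset b x)"
proof
  assume "colourings (cycleC b) m \<noteq> {}"
  then obtain \<kappa> where k: "\<kappa> \<in> colourings (cycleC b) m" by blast
  have "image_mset \<kappa> (mset_set (fst (cycleC b))) = image_mset (\<lambda>_. \<kappa> [0]) (mset_set (fst (cycleC b)))"
    by (rule image_mset_cong) (use cycleC_colouring_const[OF k] in \<open>auto simp: fst_cycleC\<close>)
  then have "m = replicate_mset b (\<kappa> [0])"
    using colouringsD(3)[OF k] by (simp add: image_mset_const_eq card_cycleC)
  moreover have "0 < \<kappa> [0]" using colouringsD(2)[OF k, of "[0]"] assms by (auto simp: fst_cycleC)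
  ultimately show "\<exists>x>0. m = replicate_mset b x" by blast
next
  assume "\<exists>x>0. m = replicate_mset b x"
  then obtain x where x: "0 < x" "m = replicate_mset b x" by blast
  have "restrict (\<lambda>_. x) (fst (cycleC b)) \<in> colourings (cycleC b) m"
  proof (rule colouringsI)
    show "edge_ok k (restrict (\<lambda>_. x) (fst (cycleC b)) u) (restrict (\<lambda>_. x) (fst (cycleC b)) v)"
      if "u \<in> fst (cycleC b)" "v \<in> fst (cycleC b)" "snd (cycleC b) u v = Some k" for u v k
      using that by (auto simp: cycleC_def split: if_splits)
    have "image_mset (restrict (\<lambda>_. x) (fst (cycleC b))) (mset_set (fst (cycleC b)))
        = image_mset (\<lambda>_. x) (mset_set (fst (cycleC b)))"
      by (rule image_mset_cong) (simp add: finite_cycleC)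
    then show "image_mset (restrict (\<lambda>_. x) (fst (cycleC b))) (mset_set (fst (cycleC b))) = m"
      by (simp add: x image_mset_const_eq card_cycleC)
  qed (use x in auto)
  then show "colourings (cycleC b) m \<noteq> {}" by blast
qed

text \<open>Treats \<open>Agraph\<close>, \<open>Bgraph\<close> and \<open>Dgraph\<close>
  uniformly.\<close>

definition cycle_sum :: "ekind \<Rightarrow> nat list \<Rightarrow> egraph" where
  "cycle_sum k \<beta> = gsum_list k (map cycleC \<beta>)"

lemma cycle_sum_simps [simp]:
  "cycle_sum k [] = empty_graph" "cycle_sum k (b # \<beta>) = gsum k (cycleC b) (cycle_sum k \<beta>)"
  by (simp_all add: cycle_sum_def gsum_list_def)

lemma finite_cycle_sum: "finite (fst (cycle_sum k \<beta>))"
  by (induction \<beta>) (auto simp: empty_graph_def intro!: finite_gsum finite_cycleC)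

lemma colourings_empty_graph_iff: "colourings empty_graph m \<noteq> {} \<longleftrightarrow> m = {#}"
  by (auto simp: colourings_def proper_colouring_def empty_graph_def)

text \<open>One colour \<open>x\<close> fills the first cycle; \<open>0 < b\<close> ensures that it
  occurs, so the cross edges really constrain \<open>x\<close>.\<close>

lemma colourings_cycle_sum_Cons_iff:
  assumes "0 < b"
  shows "colourings (cycle_sum k (b # \<beta>)) m \<noteq> {} \<longleftrightarrow>
    (\<exists>x m'. m = replicate_mset b x + m' \<and> 0 < x \<and> colourings (cycle_sum k \<beta>) m' \<noteq> {} \<and>
      (\<forall>y\<in>#m'. edge_ok k x y))"
  unfolding cycle_sum_simps colourings_gsum_nonempty_iff[OF finite_cycleC finite_cycle_sum]
    colourings_cycleC_nonempty_iff[OF assms]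
proof
  assume "\<exists>m1 m2. m = m1 + m2 \<and> (\<exists>x>0. m1 = replicate_mset b x) \<and>
      colourings (cycle_sum k \<beta>) m2 \<noteq> {} \<and> (\<forall>x\<in>#m1. \<forall>y\<in>#m2. edge_ok k x y)"
  then obtain x m2 where "m = replicate_mset b x + m2" "0 < x" "colourings (cycle_sum k \<beta>) m2 \<noteq> {}"
    "\<forall>x\<in>#replicate_mset b x. \<forall>y\<in>#m2. edge_ok k x y"
    by metis
  then show "\<exists>x m'. m = replicate_mset b x + m' \<and> 0 < x \<and> colourings (cycle_sum k \<beta>) m' \<noteq> {} \<and>
      (\<forall>y\<in>#m'. edge_ok k x y)"
    using assms by (intro exI[of _ x] exI[of _ m2]) auto
next
  assume "\<exists>x m'. m = replicate_mset b x + m' \<and> 0 < x \<and> colourings (cycle_sum k \<beta>) m' \<noteq> {} \<and>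
      (\<forall>y\<in>#m'. edge_ok k x y)"
  then obtain x m' where "m = replicate_mset b x + m'" "0 < x" "colourings (cycle_sum k \<beta>) m' \<noteq> {}"
    "\<forall>y\<in>#m'. edge_ok k x y"
    by metis
  then show "\<exists>m1 m2. m = m1 + m2 \<and> (\<exists>x>0. m1 = replicate_mset b x) \<and>
      colourings (cycle_sum k \<beta>) m2 \<noteq> {} \<and> (\<forall>x\<in>#m1. \<forall>y\<in>#m2. edge_ok k x y)"
    using assms by (intro exI[of _ "replicate_mset b x"] exI[of _ m']) auto
qed

lemma comp_of_empty [simp]: "comp_of {#} = []"
  by (simp add: comp_of_def)

lemma comp_of_replicate_plus:
  assumes "0 < b" "\<forall>y\<in>#m. x < y"
  shows "comp_of (replicate_mset b x + m) = b # comp_of m"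
proof -
  have x: "x \<notin># m" using assms(2) by auto
  have "support_list (replicate_mset b x + m) = x # support_list m"
    using assms x by (simp add: insort_is_Cons less_imp_le)
  moreover have "map (count (replicate_mset b x + m)) (support_list m) = map (count m) (support_list m)"
    using x by (intro map_cong) auto
  ultimately show ?thesis using x by (simp add: comp_of_def not_in_iff)
qed

lemma mset_comp_of_replicate_plus:
  assumes "0 < b" "x \<notin># m"
  shows "mset (comp_of (replicate_mset b x + m)) = add_mset b (mset (comp_of m))"
proof -
  have "image_mset (count (replicate_mset b x + m)) (mset_set (set_mset m))
      = image_mset (count m) (mset_set (set_mset m))"
    using assms(2) by (intro image_mset_cong) auto
  then show ?thesis using assms by (simp add: mset_comp_of not_in_iff)
qed

lemma replicate_plus_filter: "replicate_mset (count m x) x + filter_mset (\<lambda>y. y \<noteq> x) m = m"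
  by (rule multiset_eqI) auto

lemma comp_of_eq_Cons_iff:
  "comp_of m = b # \<beta> \<longleftrightarrow>
    (\<exists>x m'. m = replicate_mset b x + m' \<and> 0 < b \<and> (\<forall>y\<in>#m'. x < y) \<and> comp_of m' = \<beta>)"
proof
  assume c: "comp_of m = b # \<beta>"
  then obtain x l where l: "support_list m = x # l" by (auto simp: comp_of_def)
  let ?m = "filter_mset (\<lambda>y. y \<noteq> x) m"
  have "sorted_wrt (<) (x # l)" "set_mset m = insert x (set l)"
    using l strict_sorted_list_of_set[of "set_mset m"] set_sorted_list_of_set[of "set_mset m"] by auto
  then have s: "x \<in># m" "\<forall>y\<in>#?m. x < y" by auto
  have b: "b = count m x" using c l by (simp add: comp_of_def)
  have "comp_of m = b # comp_of ?m"
    using comp_of_replicate_plus[OF _ s(2), of b] s(1) by (simp add: b replicate_plus_filter)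
  then show "\<exists>x m'. m = replicate_mset b x + m' \<and> 0 < b \<and> (\<forall>y\<in>#m'. x < y) \<and> comp_of m' = \<beta>"
    using c s b by (intro exI[of _ x] exI[of _ ?m]) (simp add: replicate_plus_filter)
qed (auto simp: comp_of_replicate_plus)

text \<open>The successive cycles take the successive variables of \<open>m\<close>; strict increase
  satisfies solid and double edges alike.\<close>

lemma colourings_cycle_sum_of_comp:
  assumes "k \<noteq> Dashed" "comp_of m = \<beta>" "0 \<notin># m"
  shows "colourings (cycle_sum k \<beta>) m \<noteq> {}"
  using assms(2,3)
proof (induction \<beta> arbitrary: m)
  case Nil
  then have "m = {#}" by (simp add: comp_of_def)
  then show ?case by (simp add: colourings_empty_graph_iff)
next
  case (Cons b \<beta>)
  then obtain x m' where m: "m = replicate_mset b x + m'" "0 < b" "\<forall>y\<in>#m'. x < y" "comp_of m' = \<beta>"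
    by (auto simp: comp_of_eq_Cons_iff)
  have "edge_ok k x y" if "y \<in># m'" for y using that m(3) assms(1) by (cases k) auto
  moreover have "0 < x" using Cons.prems(2) m(1,2) by auto
  ultimately show ?case
    unfolding colourings_cycle_sum_Cons_iff[OF m(2)]
    by (intro exI[of _ x] exI[of _ m'] conjI ballI m Cons.IH) (use m(1) Cons.prems(2) in auto)
qed

text \<open>Colours increase weakly from cycle to cycle, so the content arises by merging
  neighbouring parts. The second claim keeps multiplicities above the threshold, the third yields
  triangularity.\<close>

lemma colourings_cycle_sum_imp:
  assumes "k \<noteq> Dashed" "colourings (cycle_sum k \<beta>) m \<noteq> {}" "\<forall>b\<in>set \<beta>. 0 < b"
  shows "size m = sum_list \<beta>" "\<forall>x\<in>#m. \<exists>b\<in>set \<beta>. b \<le> count m x"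
    "length (comp_of m) < length \<beta> \<or> comp_of m = \<beta>"
proof -
  have "size m = sum_list \<beta> \<and> (\<forall>x\<in>#m. \<exists>b\<in>set \<beta>. b \<le> count m x) \<and>
    (length (comp_of m) < length \<beta> \<or> comp_of m = \<beta>)"
    using assms(2,3)
  proof (induction \<beta> arbitrary: m)
    case Nil
    then show ?case by (simp add: colourings_empty_graph_iff)
  next
    case (Cons b \<beta>)
    have b: "0 < b" using Cons.prems by simp
    obtain x m' where m: "m = replicate_mset b x + m'" "colourings (cycle_sum k \<beta>) m' \<noteq> {}"
      "\<forall>y\<in>#m'. edge_ok k x y"
      using Cons.prems(1) unfolding colourings_cycle_sum_Cons_iff[OF b] by blast
    have IH: "size m' = sum_list \<beta>" "\<forall>x\<in>#m'. \<exists>b\<in>set \<beta>. b \<le> count m' x"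
      "length (comp_of m') < length \<beta> \<or> comp_of m' = \<beta>"
      using Cons.IH[OF m(2)] Cons.prems by auto
    have le: "x \<le> y" if "y \<in># m'" for y using m(3) that assms(1) by (cases k) auto
    have "length (comp_of m) < length (b # \<beta>) \<or> comp_of m = b # \<beta>"
    \<comment> \<open>A colour that recurs later adds nothing to the support, so the composition is
      too short for \<open>b # \<beta>\<close>; a new colour is smaller than all others and puts
      \<open>b\<close> in front.\<close>
    proof (cases "x \<in># m'")
      case True
      then have "set_mset m = set_mset m'" using m(1) b by auto
      then have "length (comp_of m) = length (comp_of m')" by (simp add: comp_of_def)
      then show ?thesis using IH(3) by auto
    next
      case False
      then have "\<forall>y\<in>#m'. x < y" using le by (metis le_neq_implies_less)
      then show ?thesis using comp_of_replicate_plus[OF b] IH(3) m(1) by auto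
    qed
    moreover have "\<exists>c\<in>set (b # \<beta>). c \<le> count m y" if y: "y \<in># m" for y
    proof (cases "y \<in># m'")
      case True
      then obtain c where "c \<in> set \<beta>" "c \<le> count m' y" using IH(2) by blast
      then show ?thesis using m(1) by (intro bexI[of _ c]) auto
    next
      case False
      then have "y = x" using y m(1) b by auto
      then show ?thesis using m(1) by simp
    qed
    ultimately show ?case using m(1) IH(1) by simp
  qed
  then show "size m = sum_list \<beta>" "\<forall>x\<in>#m. \<exists>b\<in>set \<beta>. b \<le> count m x"
    "length (comp_of m) < length \<beta> \<or> comp_of m = \<beta>" by auto
qed

text \<open>Different cycles need different colours in no particular order, so the multiplicities
  matter only as a multiset.\<close>

lemma colourings_dashed_cycle_sum_iff:
  assumes "\<forall>b\<in>set \<mu>. 0 < b"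
  shows "colourings (cycle_sum Dashed \<mu>) m \<noteq> {} \<longleftrightarrow> 0 \<notin># m \<and> mset (comp_of m) = mset \<mu>"
  using assms
proof (induction \<mu> arbitrary: m)
  case Nil
  then show ?case by (auto simp: colourings_empty_graph_iff comp_of_def)
next
  case (Cons b \<mu>)
  then have b: "0 < b" and IH: "\<And>m. colourings (cycle_sum Dashed \<mu>) m \<noteq> {} \<longleftrightarrow> 0 \<notin># m \<and> mset (comp_of m) = mset \<mu>"
    by auto
  show ?case unfolding colourings_cycle_sum_Cons_iff[OF b] IH
  proof safe
    fix x m' assume h: "0 < x" "0 \<notin># m'" "mset (comp_of m') = mset \<mu>" "\<forall>y\<in>#m'. edge_ok Dashed x y"
    show "0 \<in># replicate_mset b x + m' \<Longrightarrow> False" using h b by auto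
    show "mset (comp_of (replicate_mset b x + m')) = mset (b # \<mu>)"
      using mset_comp_of_replicate_plus[OF b, of x m'] h by auto
  next
    assume h: "0 \<notin># m" "mset (comp_of m) = mset (b # \<mu>)"
    then have "b \<in> count m ` set_mset m" by (metis list.set_intros(1) set_comp_of set_mset_mset)
    then obtain x where x: "x \<in># m" "b = count m x" by blast
    let ?m = "filter_mset (\<lambda>y. y \<noteq> x) m"
    have m: "m = replicate_mset b x + ?m" by (simp add: x replicate_plus_filter)
    have "add_mset b (mset (comp_of ?m)) = mset (b # \<mu>)"
      using mset_comp_of_replicate_plus[OF b, of x ?m] m h(2) by simp
    then have "mset (comp_of ?m) = mset \<mu>" by simp
    moreover have "0 < x" using x(1) h(1) by (metis gr0I)
    moreover have "0 \<notin># ?m" "\<forall>y\<in>#?m. edge_ok Dashed x y" using h(1) by auto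
    ultimately show "\<exists>x m'. m = replicate_mset b x + m' \<and> 0 < x \<and>
        (0 \<notin># m' \<and> mset (comp_of m') = mset \<mu>) \<and> (\<forall>y\<in>#m'. edge_ok Dashed x y)"
      using m by blast
  qed
qed

text \<open>Double edges occur only inside cycles, whose colour is constant; hence every injective
  relabelling keeps a colouring proper, which makes the series symmetric.\<close>

lemma dashed_cycle_sum_edges:
  assumes "\<kappa> \<in> colourings (cycle_sum Dashed \<mu>) m" "a \<in> fst (cycle_sum Dashed \<mu>)"
    "b \<in> fst (cycle_sum Dashed \<mu>)" "snd (cycle_sum Dashed \<mu>) a b = Some k"
  shows "k = Dashed \<or> k = Double \<and> \<kappa> a = \<kappa> b"
  using assms
proof (induction \<mu> arbitrary: \<kappa> m a b)
  case (Cons c \<mu>)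
  let ?G1 = "cycleC c" and ?G2 = "cycle_sum Dashed \<mu>"
  note kl = colourings_gsum_left[OF finite_cycleC finite_cycle_sum Cons.prems(1)[unfolded cycle_sum_simps]]
  note kr = colourings_gsum_right[OF finite_cycleC finite_cycle_sum Cons.prems(1)[unfolded cycle_sum_simps]]
  consider (left) u v where "a = 0 # u" "b = 0 # v" "u \<in> fst ?G1" "v \<in> fst ?G1" "snd ?G1 u v = Some k"
    | (right) u v where "a = Suc 0 # u" "b = Suc 0 # v" "u \<in> fst ?G2" "v \<in> fst ?G2" "snd ?G2 u v = Some k"
    | (cross) "k = Dashed"
    using Cons.prems(2-4) by (auto simp: fst_gsum snd_gsum)
  then show ?case
  proof cases
    case left
    then obtain i j where ij: "u = [i]" "v = [j]" "i < c" "j < c" by (auto simp: fst_cycleC)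
    have "k = Double" using left(5) by (auto simp: cycleC_def split: if_splits)
    moreover have "\<kappa> a = \<kappa> b"
      using cycleC_colouring_const[OF kl ij(3)] cycleC_colouring_const[OF kl ij(4)] left ij by simp
    ultimately show ?thesis by simp
  next
    case right
    then show ?thesis using Cons.IH[OF kr right(3-5)] by simp
  qed simp
qed (simp add: empty_graph_def)

lemma chromX_dashed_cycle_sum_symmetric: "symmetric_series (chromX (cycle_sum Dashed \<mu>))"
proof -
  let ?G = "cycle_sum Dashed \<mu>"
  have le: "card (colourings ?G m) \<le> card (colourings ?G m')"
    if eq: "part_of m = part_of m'" and "0 \<notin># m'" for m m'
  proof -
    obtain p where p: "p permutes (set_mset m \<union> set_mset m')" "m' = image_mset p m"
      using part_of_eq_imp_permutes[OF eq] .
    have inj: "inj p" using p(1) by (rule permutes_inj)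
    show ?thesis unfolding p(2)
    proof (rule card_colourings_relabel_le[OF finite_cycle_sum])
      show "0 < p x" if "x \<in># m" for x
        using that \<open>0 \<notin># m'\<close> p(2) by (metis gr0I image_eqI set_image_mset)
      show "edge_ok e (p (\<kappa> a)) (p (\<kappa> b))"
        if "\<kappa> \<in> colourings ?G m" "a \<in> fst ?G" "b \<in> fst ?G" "snd ?G a b = Some e" for \<kappa> a b e
        using dashed_cycle_sum_edges[OF that] colourings_edge[OF that] injD[OF inj] by auto
    qed (use inj in \<open>auto intro: inj_on_subset\<close>)
  qed
  show ?thesis unfolding symmetric_series_def chromX_eq by (metis le le_antisym)
qed

subsection \<open>Schur functions\<close>

text \<open>Rows count from 1 and have length 0 outside the diagram, so neighbouring rows can be
  compared at the bottom without a case distinction.\<close>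

definition row :: "nat list \<Rightarrow> nat \<Rightarrow> nat" where
  "row \<mu> i = (if 1 \<le> i \<and> i \<le> length \<mu> then \<mu> ! (i - 1) else 0)"

definition boxes :: "nat list \<Rightarrow> (nat \<times> nat) set" where
  "boxes \<mu> = (SIGMA i:{1..length \<mu>}. {1..row \<mu> i})"

lemma boxes_iff: "(i, j) \<in> boxes \<mu> \<longleftrightarrow> 1 \<le> i \<and> 1 \<le> j \<and> j \<le> row \<mu> i"
  by (auto simp: boxes_def row_def)

lemma finite_boxes: "finite (boxes \<mu>)"
  by (simp add: boxes_def)

lemma fst_Gpart: "fst (Gpart \<mu>) = (\<lambda>(i, j). [i, j]) ` boxes \<mu>"
  by (auto simp: Gpart_def boxes_def row_def image_iff split: if_splits)

lemma Gpart_vertex_iff: "[i, j] \<in> fst (Gpart \<mu>) \<longleftrightarrow> (i, j) \<in> boxes \<mu>"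
  by (auto simp: fst_Gpart)

lemma finite_Gpart: "finite (fst (Gpart \<mu>))"
  by (simp add: fst_Gpart finite_boxes)

lemma card_Gpart_Collect: "card {v \<in> fst (Gpart \<mu>). P v} = card {(i, j) \<in> boxes \<mu>. P [i, j]}"
proof -
  have "{v \<in> fst (Gpart \<mu>). P v} = (\<lambda>(i, j). [i, j]) ` {(i, j) \<in> boxes \<mu>. P [i, j]}"
    by (auto simp: fst_Gpart)
  then show ?thesis by (simp add: card_image inj_on_def split_def prod_eq_iff)
qed

lemma sum_row: "(\<Sum>i=1..k. row \<mu> i) = sum_list (take k \<mu>)"
proof (induction k)
  case (Suc k)
  then show ?case by (cases "k < length \<mu>") (simp_all add: take_Suc_conv_app_nth row_def)
qed simp

lemma sum_list_take_mono: "k \<le> l \<Longrightarrow> sum_list (take k \<mu>) \<le> sum_list (take l (\<mu> :: nat list))"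
  unfolding sum_row[symmetric] by (rule sum_mono2) auto

lemma card_Gpart: "card (fst (Gpart \<mu>)) = sum_list \<mu>"
proof -
  have "card (fst (Gpart \<mu>)) = card (boxes \<mu>)"
    by (simp add: fst_Gpart card_image inj_on_def split_def prod_eq_iff)
  also have "\<dots> = (\<Sum>i=1..length \<mu>. row \<mu> i)" unfolding boxes_def by simp
  also have "\<dots> = sum_list \<mu>" unfolding sum_row by simp
  finally show ?thesis .
qed

lemma row_antimono:
  assumes "is_partition \<mu>" "1 \<le> i" "i \<le> i'" shows "row \<mu> i' \<le> row \<mu> i"
proof (cases "i' \<le> length \<mu> \<and> i < i'")
  case True
  then have "\<mu> ! (i' - 1) \<le> \<mu> ! (i - 1)"
    using assms sorted_wrt_nth_less[of "(\<ge>)" \<mu> "i - 1" "i' - 1"] by (auto simp: is_partition_def)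
  then show ?thesis using True assms by (simp add: row_def)
next
  case False
  then show ?thesis using assms by (cases "i = i'") (auto simp: row_def)
qed

lemma boxes_up:
  assumes "is_partition \<mu>" "(i', j) \<in> boxes \<mu>" "1 \<le> i" "i \<le> i'" shows "(i, j) \<in> boxes \<mu>"
  using row_antimono[OF assms(1,3,4)] assms by (auto simp: boxes_iff)

lemma Gpart_row_mono:
  assumes "\<kappa> \<in> colourings (Gpart \<mu>) m" "(i, j') \<in> boxes \<mu>" "1 \<le> j" "j \<le> j'"
  shows "\<kappa> [i, j] \<le> \<kappa> [i, j']"
  using assms(4,2)
proof (induction j' rule: dec_induct)
  case (step k)
  have "(i, k) \<in> boxes \<mu>" using step assms(3) by (auto simp: boxes_iff)
  moreover have "snd (Gpart \<mu>) [i, k] [i, Suc k] = Some Double" by (auto simp: Gpart_def)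
  ultimately have "\<kappa> [i, k] \<le> \<kappa> [i, Suc k]"
    using colourings_edge[OF assms(1), of "[i, k]" "[i, Suc k]" Double] step.prems
    by (simp add: Gpart_vertex_iff)
  then show ?case using step.IH[OF \<open>(i, k) \<in> boxes \<mu>\<close>] by simp
qed simp

lemma Gpart_column_step:
  assumes "is_partition \<mu>" "\<kappa> \<in> colourings (Gpart \<mu>) m" "(Suc i, j) \<in> boxes \<mu>" "1 \<le> i"
  shows "\<kappa> [i, j] < \<kappa> [Suc i, j]"
proof -
  have "(i, j) \<in> boxes \<mu>" using boxes_up[OF assms(1,3,4)] by simp
  moreover have "snd (Gpart \<mu>) [i, j] [Suc i, j] = Some Solid" by (auto simp: Gpart_def)
  ultimately show ?thesis
    using colourings_edge[OF assms(2), of "[i, j]" "[Suc i, j]" Solid] assms(3)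
    by (simp add: Gpart_vertex_iff)
qed

lemma Gpart_column_strict:
  assumes "is_partition \<mu>" "\<kappa> \<in> colourings (Gpart \<mu>) m" "(i', j) \<in> boxes \<mu>" "1 \<le> i" "i < i'"
  shows "\<kappa> [i, j] < \<kappa> [i', j]"
  using Suc_leI[OF assms(5)] assms(3)
proof (induction i' rule: dec_induct)
  case base
  then show ?case using Gpart_column_step assms by blast
next
  case (step k)
  have "(k, j) \<in> boxes \<mu>" using boxes_up[OF assms(1) step.prems] step.hyps assms(4) by simp
  then have "\<kappa> [i, j] < \<kappa> [k, j]" by (rule step.IH)
  also have "\<dots> < \<kappa> [Suc k, j]"
    using Gpart_column_step[OF assms(1,2) step.prems] step.hyps assms(4) by simp
  finally show ?case .
qed

section \<open>Tableaux as chains of shapes\<close>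

text \<open>For fixed \<open>c\<close> these are the row lengths of the subtableau with entries at
  most \<open>c\<close>; over all \<open>c\<close> they form the Gelfand-Tsetlin pattern of the
  tableau.\<close>

definition row_count :: "nat list \<Rightarrow> (nat list \<Rightarrow> nat) \<Rightarrow> nat \<Rightarrow> nat \<Rightarrow> nat" where
  "row_count \<mu> \<kappa> c i = card {j \<in> {1..row \<mu> i}. \<kappa> [i, j] \<le> c}"

lemma row_count_le_row: "row_count \<mu> \<kappa> c i \<le> row \<mu> i"
proof -
  have "card {j \<in> {1..row \<mu> i}. \<kappa> [i, j] \<le> c} \<le> card {1..row \<mu> i}" by (rule card_mono) auto
  then show ?thesis by (simp add: row_count_def)
qed

lemma row_count_mono: "c \<le> c' \<Longrightarrow> row_count \<mu> \<kappa> c i \<le> row_count \<mu> \<kappa> c' i"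
  unfolding row_count_def by (rule card_mono) auto

lemma row_count_eqI:
  assumes "\<And>j. 1 \<le> j \<Longrightarrow> j \<le> row \<mu> i \<Longrightarrow> \<kappa> [i, j] \<le> c \<longleftrightarrow> j \<le> k" "k \<le> row \<mu> i"
  shows "row_count \<mu> \<kappa> c i = k"
proof -
  have "{j \<in> {1..row \<mu> i}. \<kappa> [i, j] \<le> c} = {1..k}" using assms by auto
  then show ?thesis by (simp add: row_count_def)
qed

text \<open>Rows increase weakly, so the entries at most \<open>c\<close> form an initial segment.
  Thus the pattern determines the tableau.\<close>

lemma le_iff_row_count:
  assumes "\<kappa> \<in> colourings (Gpart \<mu>) m" "(i, j) \<in> boxes \<mu>"
  shows "\<kappa> [i, j] \<le> c \<longleftrightarrow> j \<le> row_count \<mu> \<kappa> c i"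
proof -
  let ?S = "{j \<in> {1..row \<mu> i}. \<kappa> [i, j] \<le> c}"
  have "\<exists>k. ?S = {1..k}"
  proof (cases "?S = {}")
    case False
    have "Max ?S \<in> ?S" using False by (intro Max_in) auto
    then have M: "(i, Max ?S) \<in> boxes \<mu>" "\<kappa> [i, Max ?S] \<le> c" using assms(2) by (simp_all add: boxes_iff)
    have "{1..Max ?S} \<subseteq> ?S"
    proof
      fix j assume j: "j \<in> {1..Max ?S}"
      have "\<kappa> [i, j] \<le> \<kappa> [i, Max ?S]" using Gpart_row_mono[OF assms(1) M(1)] j by simp
      then show "j \<in> ?S" using M j by (simp add: boxes_iff)
    qed
    moreover have "?S \<subseteq> {1..Max ?S}" by auto
    ultimately show ?thesis by blast
  next
    case True
    then show ?thesis by (intro exI[of _ 0]) auto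
  qed
  then obtain k where S: "?S = {1..k}" by blast
  then have "row_count \<mu> \<kappa> c i = k" unfolding row_count_def by simp
  moreover have "j \<in> ?S \<longleftrightarrow> j \<in> {1..k}" by (rule arg_cong[OF S])
  ultimately show ?thesis using assms(2) by (simp add: boxes_iff)
qed

text \<open>Column strictness as interlacing: above the last entry at most \<open>Suc c\<close> in a
  row stands an entry at most \<open>c\<close>.\<close>

lemma row_count_shift:
  assumes "is_partition \<mu>" "\<kappa> \<in> colourings (Gpart \<mu>) m" "1 \<le> i"
  shows "row_count \<mu> \<kappa> (Suc c) (Suc i) \<le> row_count \<mu> \<kappa> c i"
proof (cases "row_count \<mu> \<kappa> (Suc c) (Suc i) = 0")
  case False
  let ?j = "row_count \<mu> \<kappa> (Suc c) (Suc i)"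
  have b: "(Suc i, ?j) \<in> boxes \<mu>" using False row_count_le_row by (simp add: boxes_iff Suc_le_eq)
  have "\<kappa> [Suc i, ?j] \<le> Suc c" using le_iff_row_count[OF assms(2) b] by simp
  then have "\<kappa> [i, ?j] \<le> c" using Gpart_column_step[OF assms(1,2) b assms(3)] by simp
  moreover have "(i, ?j) \<in> boxes \<mu>" using boxes_up[OF assms(1) b assms(3)] by simp
  ultimately show ?thesis using le_iff_row_count[OF assms(2)] by simp
qed simp

text \<open>The converse: the threshold form \<open>T\<close> gives weakly increasing rows, and
  \<open>shift\<close> gives strictly increasing columns.\<close>

lemma Gpart_colouringI:
  assumes "\<kappa> \<in> extensional (fst (Gpart \<mu>))" "\<And>i j. (i, j) \<in> boxes \<mu> \<Longrightarrow> 0 < \<kappa> [i, j]"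
    "image_mset \<kappa> (mset_set (fst (Gpart \<mu>))) = m"
    and T: "\<And>i j c. (i, j) \<in> boxes \<mu> \<Longrightarrow> \<kappa> [i, j] \<le> c \<longleftrightarrow> j \<le> T c i"
    and shift: "\<And>c i. 1 \<le> i \<Longrightarrow> T (Suc c) (Suc i) \<le> T c i"
  shows "\<kappa> \<in> colourings (Gpart \<mu>) m"
proof (rule colouringsI)
  show "0 < \<kappa> v" if "v \<in> fst (Gpart \<mu>)" for v using that assms(2) by (auto simp: fst_Gpart)
  fix a b k assume ab: "a \<in> fst (Gpart \<mu>)" "b \<in> fst (Gpart \<mu>)" "snd (Gpart \<mu>) a b = Some k"
  then consider i j where "a = [i, j]" "b = [Suc i, j]" "k = Solid"
    | i j where "a = [i, j]" "b = [i, Suc j]" "k = Double"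
    by (auto simp: Gpart_def split: if_splits)
  then show "edge_ok k (\<kappa> a) (\<kappa> b)"
  proof cases
    case 1
    then have b: "(i, j) \<in> boxes \<mu>" "(Suc i, j) \<in> boxes \<mu>" using ab by (simp_all add: Gpart_vertex_iff)
    \<comment> \<open>Positivity provides the predecessor at which \<open>shift\<close> is
      applied.\<close>
    obtain c where c: "\<kappa> [Suc i, j] = Suc c" using assms(2)[OF b(2)] gr0_implies_Suc by blast
    then have "j \<le> T (Suc c) (Suc i)" using T[OF b(2), of "Suc c"] by simp
    also have "\<dots> \<le> T c i" using b(1) by (intro shift) (simp add: boxes_iff)
    finally have "\<kappa> [i, j] \<le> c" using T[OF b(1), of c] by simp
    then show ?thesis using 1 c by simp
  next
    case 2
    then have b: "(i, j) \<in> boxes \<mu>" "(i, Suc j) \<in> boxes \<mu>" using ab by (simp_all add: Gpart_vertex_iff)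
    have "Suc j \<le> T (\<kappa> [i, Suc j]) i" using T[OF b(2), of "\<kappa> [i, Suc j]"] by simp
    then show ?thesis using 2 T[OF b(1), of "\<kappa> [i, Suc j]"] by simp
  qed
qed (use assms in auto)

lemma card_le_eq_sum_row_count:
  "card {v \<in> fst (Gpart \<mu>). \<kappa> v \<le> c} = (\<Sum>i=1..length \<mu>. row_count \<mu> \<kappa> c i)"
proof -
  have "{(i, j) \<in> boxes \<mu>. \<kappa> [i, j] \<le> c} = (SIGMA i:{1..length \<mu>}. {j \<in> {1..row \<mu> i}. \<kappa> [i, j] \<le> c})"
    by (auto simp: boxes_def)
  then show ?thesis by (simp add: card_Gpart_Collect row_count_def)
qed

lemma count_image_mset_set: "finite A \<Longrightarrow> count (image_mset f (mset_set A)) x = card {a \<in> A. f a = x}"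
  by (simp add: count_image_mset_eq_card_vimage)

lemma count_Suc_eq_sum_row_count:
  "count (image_mset \<kappa> (mset_set (fst (Gpart \<mu>)))) (Suc c)
    = (\<Sum>i=1..length \<mu>. row_count \<mu> \<kappa> (Suc c) i) - (\<Sum>i=1..length \<mu>. row_count \<mu> \<kappa> c i)"
proof -
  have "{v \<in> fst (Gpart \<mu>). \<kappa> v = Suc c} = {v \<in> fst (Gpart \<mu>). \<kappa> v \<le> Suc c} - {v \<in> fst (Gpart \<mu>). \<kappa> v \<le> c}"
    by auto
  then have "card {v \<in> fst (Gpart \<mu>). \<kappa> v = Suc c}
      = card {v \<in> fst (Gpart \<mu>). \<kappa> v \<le> Suc c} - card {v \<in> fst (Gpart \<mu>). \<kappa> v \<le> c}"
    using finite_Gpart by (auto intro!: card_Diff_subset)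
  then show ?thesis by (simp add: count_image_mset_set[OF finite_Gpart] card_le_eq_sum_row_count)
qed

text \<open>The Bender--Knuth involution in terms of Gelfand--Tsetlin patterns: with the row lengths
  \<open>\<nu>\<close>, \<open>\<lambda>\<close> of the subtableaux with entries at most \<open>d\<close> and at most \<open>d + 2\<close> fixed, the row lengths
  for \<open>d + 1\<close> range independently over the intervals \<open>[bk_lo i, bk_hi i]\<close>, and the involution
  reflects each of them in the midpoint of its interval.\<close>

definition bk_lo :: "nat list \<Rightarrow> nat \<Rightarrow> (nat list \<Rightarrow> nat) \<Rightarrow> nat \<Rightarrow> nat" where
  "bk_lo \<mu> d \<kappa> i = max (row_count \<mu> \<kappa> d i) (row_count \<mu> \<kappa> (Suc (Suc d)) (Suc i))"

text \<open>The first row has no row above it, so only the outer shape bounds it.\<close>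

definition bk_hi :: "nat list \<Rightarrow> nat \<Rightarrow> (nat list \<Rightarrow> nat) \<Rightarrow> nat \<Rightarrow> nat" where
  "bk_hi \<mu> d \<kappa> i = (if i = 1 then row_count \<mu> \<kappa> (Suc (Suc d)) 1
     else min (row_count \<mu> \<kappa> (Suc (Suc d)) i) (row_count \<mu> \<kappa> d (i - 1)))"

definition bk_count :: "nat list \<Rightarrow> nat \<Rightarrow> (nat list \<Rightarrow> nat) \<Rightarrow> nat \<Rightarrow> nat" where
  "bk_count \<mu> d \<kappa> i = bk_lo \<mu> d \<kappa> i + bk_hi \<mu> d \<kappa> i - row_count \<mu> \<kappa> (Suc d) i"

definition bk :: "nat list \<Rightarrow> nat \<Rightarrow> (nat list \<Rightarrow> nat) \<Rightarrow> nat list \<Rightarrow> nat" where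
  "bk \<mu> d \<kappa> = (\<lambda>v\<in>fst (Gpart \<mu>). if \<kappa> v \<in> {Suc d, Suc (Suc d)}
     then if v ! 1 \<le> bk_count \<mu> d \<kappa> (v ! 0) then Suc d else Suc (Suc d) else \<kappa> v)"

text \<open>The lower bound of row \<open>i\<close> and the upper bound of row \<open>i + 1\<close>
  are the maximum and the minimum of the same two numbers, so together they contribute the sum of
  these.\<close>

lemma sum_bk_lo_hi:
  "(\<Sum>i=1..length \<mu>. bk_lo \<mu> d \<kappa> i + bk_hi \<mu> d \<kappa> i)
    = (\<Sum>i=1..length \<mu>. row_count \<mu> \<kappa> d i) + (\<Sum>i=1..length \<mu>. row_count \<mu> \<kappa> (Suc (Suc d)) i)"
proof -
  let ?n = "row_count \<mu> \<kappa> d" and ?l = "row_count \<mu> \<kappa> (Suc (Suc d))"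
  \<comment> \<open>The added minimum is the partner of the last maximum, whose upper bound belongs
    to the next row.\<close>
  have rec: "(\<Sum>i=1..Suc k. bk_lo \<mu> d \<kappa> i + bk_hi \<mu> d \<kappa> i) + min (?l (Suc (Suc k))) (?n (Suc k))
      = (\<Sum>i=1..Suc k. ?n i) + (\<Sum>i=1..Suc (Suc k). ?l i)" for k
    by (induction k) (auto simp: bk_lo_def bk_hi_def min_def max_def)
  \<comment> \<open>Below the diagram the row is empty, so both this minimum and the surplus term of
    \<open>rec\<close> vanish.\<close>
  have last: "?l (Suc (length \<mu>)) = 0"
    using row_count_le_row[of \<mu> \<kappa> "Suc (Suc d)" "Suc (length \<mu>)"] by (simp add: row_def)
  show ?thesis
  proof (cases "length \<mu>")
    case (Suc k)
    then show ?thesis using last rec[of k] by simp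
  qed simp
qed

context
  fixes \<mu> :: "nat list" and \<kappa> m and d :: nat
  assumes part: "is_partition \<mu>" and k: "\<kappa> \<in> colourings (Gpart \<mu>) m"
begin

text \<open>Interlacing of the three consecutive shapes; in particular the subtraction in
  \<open>bk_count\<close> does not truncate.\<close>

lemma row_count_bk_bounds:
  assumes "1 \<le> i"
  shows "bk_lo \<mu> d \<kappa> i \<le> row_count \<mu> \<kappa> (Suc d) i" "row_count \<mu> \<kappa> (Suc d) i \<le> bk_hi \<mu> d \<kappa> i"
proof -
  show "bk_lo \<mu> d \<kappa> i \<le> row_count \<mu> \<kappa> (Suc d) i"
    using row_count_shift[OF part k assms] row_count_mono by (simp add: bk_lo_def)
  show "row_count \<mu> \<kappa> (Suc d) i \<le> bk_hi \<mu> d \<kappa> i"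
  proof (cases "i = 1")
    case False
    then show ?thesis
      using row_count_shift[OF part k, of "i - 1" d] row_count_mono assms by (simp add: bk_hi_def)
  qed (simp add: bk_hi_def row_count_mono)
qed

lemma bk_count_bounds:
  assumes "1 \<le> i"
  shows "row_count \<mu> \<kappa> d i \<le> bk_count \<mu> d \<kappa> i" "bk_count \<mu> d \<kappa> i \<le> row_count \<mu> \<kappa> (Suc (Suc d)) i"
    "row_count \<mu> \<kappa> (Suc (Suc d)) (Suc i) \<le> bk_count \<mu> d \<kappa> i" "bk_count \<mu> d \<kappa> (Suc i) \<le> row_count \<mu> \<kappa> d i"
proof -
  have "bk_lo \<mu> d \<kappa> i \<le> bk_count \<mu> d \<kappa> i" "bk_count \<mu> d \<kappa> i \<le> bk_hi \<mu> d \<kappa> i"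
    "bk_count \<mu> d \<kappa> (Suc i) \<le> bk_hi \<mu> d \<kappa> (Suc i)"
    using row_count_bk_bounds[OF assms] row_count_bk_bounds[of "Suc i"] by (simp_all add: bk_count_def)
  then show "row_count \<mu> \<kappa> d i \<le> bk_count \<mu> d \<kappa> i" "bk_count \<mu> d \<kappa> i \<le> row_count \<mu> \<kappa> (Suc (Suc d)) i"
    "row_count \<mu> \<kappa> (Suc (Suc d)) (Suc i) \<le> bk_count \<mu> d \<kappa> i" "bk_count \<mu> d \<kappa> (Suc i) \<le> row_count \<mu> \<kappa> d i"
    using assms by (auto simp: bk_lo_def bk_hi_def split: if_splits)
qed

text \<open>The new tableau has the old pattern with only level \<open>Suc d\<close> replaced by its
  reflection.\<close>

lemma bk_le_iff:
  assumes b: "(i, j) \<in> boxes \<mu>"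
  shows "bk \<mu> d \<kappa> [i, j] \<le> c \<longleftrightarrow> j \<le> (if c = Suc d then bk_count \<mu> d \<kappa> i else row_count \<mu> \<kappa> c i)"
proof -
  note iff = le_iff_row_count[OF k b]
  have i: "1 \<le> i" using b by (simp add: boxes_iff)
  have v: "bk \<mu> d \<kappa> [i, j] = (if \<kappa> [i, j] \<in> {Suc d, Suc (Suc d)}
     then if j \<le> bk_count \<mu> d \<kappa> i then Suc d else Suc (Suc d) else \<kappa> [i, j])"
    using b by (simp add: bk_def Gpart_vertex_iff)
  show ?thesis
  proof (cases "\<kappa> [i, j] \<in> {Suc d, Suc (Suc d)}")
    case True
    then show ?thesis using iff[of c] by (auto simp: v)
  next
    case False
    \<comment> \<open>An untouched entry is at most \<open>d\<close> or exceeds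
      \<open>d + 2\<close>, and the reflected row length lies between those of these two levels, so
      it separates such entries as level \<open>Suc d\<close> did.\<close>
    have "\<kappa> [i, j] \<le> Suc d \<longleftrightarrow> j \<le> bk_count \<mu> d \<kappa> i"
    proof
      assume "\<kappa> [i, j] \<le> Suc d"
      then have "\<kappa> [i, j] \<le> d" using False by simp
      then show "j \<le> bk_count \<mu> d \<kappa> i" using iff[of d] bk_count_bounds(1)[OF i] by simp
    next
      assume "j \<le> bk_count \<mu> d \<kappa> i"
      then have "\<kappa> [i, j] \<le> Suc (Suc d)" using iff bk_count_bounds(2)[OF i] by simp
      then show "\<kappa> [i, j] \<le> Suc d" using False by simp
    qed
    moreover have "bk \<mu> d \<kappa> [i, j] = \<kappa> [i, j]" using False by (simp add: v)
    ultimately show ?thesis using iff[of c] by (cases "c = Suc d") simp_all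
  qed
qed

lemma row_count_bk:
  assumes "1 \<le> i"
  shows "row_count \<mu> (bk \<mu> d \<kappa>) c i = (if c = Suc d then bk_count \<mu> d \<kappa> i else row_count \<mu> \<kappa> c i)"
proof (rule row_count_eqI)
  show "bk \<mu> d \<kappa> [i, j] \<le> c \<longleftrightarrow> j \<le> (if c = Suc d then bk_count \<mu> d \<kappa> i else row_count \<mu> \<kappa> c i)"
    if "1 \<le> j" "j \<le> row \<mu> i" for j
    using that assms by (intro bk_le_iff) (simp add: boxes_iff)
  show "(if c = Suc d then bk_count \<mu> d \<kappa> i else row_count \<mu> \<kappa> c i) \<le> row \<mu> i"
    using bk_count_bounds(2)[OF assms] row_count_le_row[of \<mu> \<kappa>] by (auto intro: order_trans)
qed

text \<open>Multiplicities are differences of the sizes of consecutive shapes, and reflecting the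
  middle shape exchanges the two differences.\<close>

lemma image_mset_bk:
  "image_mset (bk \<mu> d \<kappa>) (mset_set (fst (Gpart \<mu>))) = image_mset (transpose (Suc d) (Suc (Suc d))) m"
proof (rule multiset_eqI)
  fix x
  let ?t = "transpose (Suc d) (Suc (Suc d))" and ?B = "image_mset (bk \<mu> d \<kappa>) (mset_set (fst (Gpart \<mu>)))"
  let ?N = "\<lambda>c. \<Sum>i=1..length \<mu>. row_count \<mu> \<kappa> c i" and ?R = "\<Sum>i=1..length \<mu>. bk_count \<mu> d \<kappa> i"
  have t: "count (image_mset ?t m) x = count m (?t x)"
    using count_image_mset_inj[OF inj_transpose, of "Suc d" "Suc (Suc d)" m "?t x"] by simp
  have m: "count m (Suc c) = ?N (Suc c) - ?N c" for c
    using count_Suc_eq_sum_row_count[of \<kappa> \<mu> c] colouringsD(3)[OF k] by simp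
  have B: "count ?B (Suc c) = (if c = d then ?R else ?N (Suc c)) - (if c = Suc d then ?R else ?N c)" for c
  proof -
    have "(\<Sum>i=1..length \<mu>. row_count \<mu> (bk \<mu> d \<kappa>) c i) = (if c = Suc d then ?R else ?N c)" for c
      by (cases "c = Suc d") (auto intro!: sum.cong simp: row_count_bk)
    then show ?thesis by (simp only: count_Suc_eq_sum_row_count nat.inject)
  qed
  have "?R + ?N (Suc d) = (\<Sum>i=1..length \<mu>. bk_lo \<mu> d \<kappa> i + bk_hi \<mu> d \<kappa> i)"
    unfolding sum.distrib[symmetric]
  proof (rule sum.cong)
    fix i assume "i \<in> {1..length \<mu>}"
    then show "bk_count \<mu> d \<kappa> i + row_count \<mu> \<kappa> (Suc d) i = bk_lo \<mu> d \<kappa> i + bk_hi \<mu> d \<kappa> i"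
      using row_count_bk_bounds(2)[of i] by (simp add: bk_count_def)
  qed simp
  \<comment> \<open>The middle size \<open>?R\<close> exceeds the inner size by exactly what the
    outer size exceeded the old middle one.\<close>
  then have sum: "?R + ?N (Suc d) = ?N d + ?N (Suc (Suc d))" by (simp only: sum_bk_lo_hi)
  have mono: "?N d \<le> ?N (Suc d)" "?N (Suc d) \<le> ?N (Suc (Suc d))"
    by (auto intro!: sum_mono row_count_mono)
  show "count ?B x = count (image_mset ?t m) x"
  proof (cases x)
    \<comment> \<open>The difference formula covers successors only; colour 0 is absent on both
      sides.\<close>
    case 0
    have "\<not> bk \<mu> d \<kappa> v \<le> 0" if v: "v \<in> fst (Gpart \<mu>)" for v
    proof -
      obtain i j where ij: "v = [i, j]" "(i, j) \<in> boxes \<mu>" using v by (auto simp: fst_Gpart)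
      then show ?thesis
        using bk_le_iff[OF ij(2), of 0] le_iff_row_count[OF k ij(2), of 0] colouringsD(2)[OF k v] by simp
    qed
    then have "count ?B x = 0"
      using finite_Gpart 0 by (simp add: count_eq_zero_iff image_iff)
    moreover have "0 \<notin># m" by (rule colourings_zero[OF finite_Gpart k])
    ultimately show ?thesis using 0 t by (simp add: not_in_iff transpose_def)
  next
    case (Suc c)
    consider "c = d" | "c = Suc d" | "c \<noteq> d" "c \<noteq> Suc d" by blast
    then show ?thesis
    proof cases
      case 1
      then show ?thesis using t B[of d] m[of "Suc d"] sum mono Suc by simp
    next
      case 2
      then show ?thesis using t B[of "Suc d"] m[of d] sum mono Suc by simp
    next
      case 3
      then show ?thesis using t B[of c] m[of c] Suc by (simp add: transpose_def)
    qed
  qed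
qed

lemma bk_colouring: "bk \<mu> d \<kappa> \<in> colourings (Gpart \<mu>) (image_mset (transpose (Suc d) (Suc (Suc d))) m)"
proof (rule Gpart_colouringI[where T = "\<lambda>c i. if c = Suc d then bk_count \<mu> d \<kappa> i else row_count \<mu> \<kappa> c i"])
  show "bk \<mu> d \<kappa> \<in> extensional (fst (Gpart \<mu>))" by (simp add: bk_def)
  show "0 < bk \<mu> d \<kappa> [i, j]" if "(i, j) \<in> boxes \<mu>" for i j
    using that colouringsD(2)[OF k, of "[i, j]"] by (simp add: bk_def Gpart_vertex_iff)
  show "(if Suc c = Suc d then bk_count \<mu> d \<kappa> (Suc i) else row_count \<mu> \<kappa> (Suc c) (Suc i))
      \<le> (if c = Suc d then bk_count \<mu> d \<kappa> i else row_count \<mu> \<kappa> c i)" if "1 \<le> i" for c i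
    using bk_count_bounds[OF that] row_count_shift[OF part k that] by auto
qed (use bk_le_iff image_mset_bk in auto)

end

lemma Gpart_colouring_eqI:
  assumes "\<kappa> \<in> colourings (Gpart \<mu>) m" "\<kappa>' \<in> colourings (Gpart \<mu>) m'"
    "\<And>c i. 1 \<le> i \<Longrightarrow> row_count \<mu> \<kappa> c i = row_count \<mu> \<kappa>' c i"
  shows "\<kappa> = \<kappa>'"
proof (rule extensionalityI)
  fix v assume "v \<in> fst (Gpart \<mu>)"
  then obtain i j where ij: "v = [i, j]" "(i, j) \<in> boxes \<mu>" by (auto simp: fst_Gpart)
  have "\<kappa> v \<le> c \<longleftrightarrow> \<kappa>' v \<le> c" for c
    using le_iff_row_count[OF assms(1) ij(2)] le_iff_row_count[OF assms(2) ij(2)] assms(3)[of i c] ij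
    by (simp add: boxes_iff)
  then show "\<kappa> v = \<kappa>' v" by (metis order_antisym order_refl)
qed (use colouringsD(1) assms in auto)

text \<open>The intervals depend only on levels \<open>d\<close> and \<open>d + 2\<close>, which
  \<open>bk\<close> leaves alone, and a reflection in a known interval can be undone.\<close>

lemma inj_on_bk:
  assumes "is_partition \<mu>" shows "inj_on (bk \<mu> d) (colourings (Gpart \<mu>) m)"
proof (rule inj_onI)
  fix \<kappa> \<kappa>' assume k: "\<kappa> \<in> colourings (Gpart \<mu>) m" "\<kappa>' \<in> colourings (Gpart \<mu>) m" and eq: "bk \<mu> d \<kappa> = bk \<mu> d \<kappa>'"
  note rc = row_count_bk[OF assms k(1), of _ d] row_count_bk[OF assms k(2), of _ d]
  have other: "row_count \<mu> \<kappa> c i = row_count \<mu> \<kappa>' c i" if "c \<noteq> Suc d" "1 \<le> i" for c i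
    using rc[of i c] eq that by simp
  have "row_count \<mu> \<kappa> (Suc d) i = row_count \<mu> \<kappa>' (Suc d) i" if i: "1 \<le> i" for i
  proof -
    have "bk_lo \<mu> d \<kappa> i = bk_lo \<mu> d \<kappa>' i" "bk_hi \<mu> d \<kappa> i = bk_hi \<mu> d \<kappa>' i"
      using other i by (simp_all add: bk_lo_def bk_hi_def)
    moreover have "bk_count \<mu> d \<kappa> i = bk_count \<mu> d \<kappa>' i" using rc[of i "Suc d"] eq i by simp
    ultimately show ?thesis
      using row_count_bk_bounds(2)[OF assms k(1) i] row_count_bk_bounds(2)[OF assms k(2) i]
      unfolding bk_count_def by (metis diff_diff_cancel trans_le_add2)
  qed
  then show "\<kappa> = \<kappa>'" using other by (intro Gpart_colouring_eqI[OF k]) metis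
qed

section \<open>Symmetry and content of Schur functions\<close>

text \<open>Injectivity of \<open>bk\<close> gives one inequality for every monomial; applied again
  to the transposed monomial it gives the other.\<close>

lemma chromX_Gpart_transpose_Suc:
  assumes "is_partition \<mu>"
  shows "chromX (Gpart \<mu>) (image_mset (transpose (Suc d) (Suc (Suc d))) m) = chromX (Gpart \<mu>) m"
proof -
  let ?t = "transpose (Suc d) (Suc (Suc d))"
  have le: "card (colourings (Gpart \<mu>) m) \<le> card (colourings (Gpart \<mu>) (image_mset ?t m))" for m
    using bk_colouring[OF assms] finite_colourings[OF finite_Gpart]
    by (intro card_inj_on_le[OF inj_on_bk[OF assms]]) blast+
  have "image_mset ?t (image_mset ?t m) = m"
    by (simp add: image_mset.compositionality)
  then show ?thesis using le[of m] le[of "image_mset ?t m"] by (simp add: chromX_eq)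
qed

lemma chromX_Gpart_transpose:
  assumes "is_partition \<mu>" "0 < a" "a < b"
  shows "chromX (Gpart \<mu>) (image_mset (transpose a b) m) = chromX (Gpart \<mu>) m"
  using Suc_leI[OF assms(3)]
proof (induction b arbitrary: m rule: dec_induct)
  case base
  show ?case using chromX_Gpart_transpose_Suc[OF assms(1), of "a - 1" m] assms(2) by simp
next
  case (step b)
  let ?s = "transpose b (Suc b)"
  have s: "chromX (Gpart \<mu>) (image_mset ?s m) = chromX (Gpart \<mu>) m" for m
    using chromX_Gpart_transpose_Suc[OF assms(1), of "b - 1" m] step.hyps by simp
  \<comment> \<open>Conjugation by an adjacent transposition moves the larger index up by
    one.\<close>
  have "transpose a (Suc b) = ?s \<circ> transpose a b \<circ> ?s"
    using step.hyps by (auto simp: fun_eq_iff transpose_def)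
  then have "image_mset (transpose a (Suc b)) m = image_mset ?s (image_mset (transpose a b) (image_mset ?s m))"
    by (simp add: image_mset.compositionality comp_assoc)
  then show ?case using s step.IH by simp
qed

lemma chromX_Gpart_symmetric:
  assumes "is_partition \<mu>" shows "symmetric_series (chromX (Gpart \<mu>))"
  unfolding symmetric_series_def
proof (intro allI impI)
  fix m m' assume m: "0 \<notin># m" "0 \<notin># m'" "part_of m = part_of m'"
  obtain p where p: "p permutes (set_mset m \<union> set_mset m')" "m' = image_mset p m"
    using part_of_eq_imp_permutes[OF m(3)] .
  have "finite (set_mset m \<union> set_mset m')" by simp
  with p(1) have "chromX (Gpart \<mu>) (image_mset p k) = chromX (Gpart \<mu>) k" for k
  proof (induction p arbitrary: k rule: permutes_induct)
    case (swap a b p)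
    have "0 < a" "0 < b" using swap.hyps m by (auto intro: gr0I)
    then have "chromX (Gpart \<mu>) (image_mset (transpose a b) k) = chromX (Gpart \<mu>) k" for k
      using chromX_Gpart_transpose[OF assms, of a b k] chromX_Gpart_transpose[OF assms, of b a k] swap.hyps(3)
      by (cases "a < b") (auto simp: transpose_commute)
    then show ?case using swap.IH by (metis multiset.map_comp)
  qed simp_all
  then show "chromX (Gpart \<mu>) m = chromX (Gpart \<mu>) m'" using p(2) by simp
qed

text \<open>\<open>C\<close> meets each column in at most \<open>card C\<close> boxes, and sliding these boxes
  upwards moves all of them into the first \<open>card C\<close> rows.\<close>

lemma Gpart_sum_count_le:
  assumes part: "is_partition \<mu>" and k: "\<kappa> \<in> colourings (Gpart \<mu>) m" and "finite C"
  shows "(\<Sum>c\<in>C. count m c) \<le> sum_list (take (card C) \<mu>)"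
proof -
  let ?S = "{(i, j) \<in> boxes \<mu>. \<kappa> [i, j] \<in> C}"
  let ?U = "\<lambda>i j. {i' \<in> {1..i}. \<kappa> [i', j] \<in> C}"
  have "(\<Sum>c\<in>C. count m c) = (\<Sum>c\<in>C. card {v \<in> fst (Gpart \<mu>). \<kappa> v = c})"
    using colouringsD(3)[OF k] by (auto simp: count_image_mset_set[OF finite_Gpart, symmetric])
  also have "\<dots> = card (\<Union>c\<in>C. {v \<in> fst (Gpart \<mu>). \<kappa> v = c})"
    by (rule card_UN_disjoint[symmetric]) (use assms(3) finite_Gpart in auto)
  also have "(\<Union>c\<in>C. {v \<in> fst (Gpart \<mu>). \<kappa> v = c}) = {v \<in> fst (Gpart \<mu>). \<kappa> v \<in> C}" by auto
  also have "card \<dots> = card ?S" by (rule card_Gpart_Collect)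
  also have "\<dots> \<le> card (SIGMA i:{1..card C}. {1..row \<mu> i})"
  proof (rule card_inj_on_le)
    let ?f = "\<lambda>(i, j). (card (?U i j), j)"
    have less: "card (?U i j) < card (?U i' j)" if "i < i'" "(i', j) \<in> ?S" for i i' j
    proof (rule psubset_card_mono[rotated])
      have "i' \<in> ?U i' j" "i' \<notin> ?U i j" "?U i j \<subseteq> ?U i' j" using that by (auto simp: boxes_iff)
      then show "?U i j \<subset> ?U i' j" by blast
    qed simp
    show "inj_on ?f ?S"
    proof (rule inj_onI)
      fix p q assume pq: "p \<in> ?S" "q \<in> ?S" "?f p = ?f q"
      obtain i j i' where ij: "p = (i, j)" "q = (i', j)" using pq(3) by (cases p; cases q) auto
      then have "card (?U i j) = card (?U i' j)" using pq(3) by simp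
      moreover have "\<not> i < i'" "\<not> i' < i"
        using less[of i i' j] less[of i' i j] pq(1,2) calculation unfolding ij by linarith+
      ultimately have "i = i'" by simp
      then show "p = q" using ij by simp
    qed
    show "?f ` ?S \<subseteq> (SIGMA i:{1..card C}. {1..row \<mu> i})"
    proof
      fix p assume "p \<in> ?f ` ?S"
      then obtain i j where ij: "(i, j) \<in> boxes \<mu>" "\<kappa> [i, j] \<in> C" and p: "p = (card (?U i j), j)" by auto
      have up: "(i', j) \<in> boxes \<mu>" if "i' \<in> ?U i j" for i' using that boxes_up[OF part ij(1)] by simp
      have "i \<in> ?U i j" using ij by (simp add: boxes_iff)
      then have pos: "1 \<le> card (?U i j)" 
        by (auto simp: Suc_le_eq card_gt_0_iff)
      have le: "card (?U i j) \<le> card C"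
      proof (rule card_inj_on_le[of "\<lambda>i'. \<kappa> [i', j]"])
        show "inj_on (\<lambda>i'. \<kappa> [i', j]) (?U i j)"
        proof (rule inj_onI)
          fix a b assume "a \<in> ?U i j" "b \<in> ?U i j" "\<kappa> [a, j] = \<kappa> [b, j]"
          then show "a = b"
            using Gpart_column_strict[OF part k up, of a b] Gpart_column_strict[OF part k up, of b a]
            by (cases a b rule: linorder_cases) auto
        qed
      qed (use assms(3) in auto)
      \<comment> \<open>Sliding never moves a box down, so its image stays inside the
        diagram.\<close>
      have "card (?U i j) \<le> i" using card_mono[OF finite_atLeastAtMost[of 1 i], of "?U i j"] by fastforce
      then have "(card (?U i j), j) \<in> boxes \<mu>" using boxes_up[OF part ij(1) pos] by simp
      then show "p \<in> (SIGMA i:{1..card C}. {1..row \<mu> i})" using le by (simp add: p boxes_iff)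
    qed
  qed simp
  also have "\<dots> = sum_list (take (card C) \<mu>)" unfolding sum_row[symmetric] by simp
  finally show ?thesis .
qed

text \<open>The first \<open>k\<close> entries of \<open>part_of m\<close> are multiplicities of at
  most \<open>k\<close> distinct colours, to which \<open>Gpart_sum_count_le\<close>
  applies.\<close>

lemma Gpart_dominance:
  assumes "is_partition \<mu>" "colourings (Gpart \<mu>) m \<noteq> {}"
  shows "sum_list (take k (part_of m)) \<le> sum_list (take k \<mu>)"
proof -
  obtain \<kappa> where c: "\<kappa> \<in> colourings (Gpart \<mu>) m" using assms(2) by blast
  obtain ys where ys: "distinct ys" "map (count m) ys = part_of m"
    using ex_filling[of m] by (auto simp: fillings_def)
  have "sum_list (take k (part_of m)) = (\<Sum>c\<in>set (take k ys). count m c)"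
    using ys by (simp add: sum_list_distinct_conv_sum_set take_map flip: ys(2))
  also have "\<dots> \<le> sum_list (take (card (set (take k ys))) \<mu>)"
    by (rule Gpart_sum_count_le[OF assms(1) c]) simp
  \<comment> \<open>Fewer than \<open>k\<close> colours may be available, hence monotonicity instead
    of equality.\<close>
  also have "\<dots> \<le> sum_list (take k \<mu>)"
    by (intro sum_list_take_mono) (use ys(1) in \<open>simp add: distinct_card\<close>)
  finally show ?thesis .
qed

text \<open>The tableau whose row \<open>i\<close> is filled with \<open>i\<close> has a content
  \<open>m0\<close> of type \<open>\<mu>\<close>; symmetry transfers the nonzero coefficient to
  every \<open>m\<close> of that type.\<close>

lemma colourings_Gpart_of_part:
  assumes "is_partition \<mu>" "part_of m = \<mu>" "0 \<notin># m"
  shows "colourings (Gpart \<mu>) m \<noteq> {}"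
proof -
  define \<kappa> where "\<kappa> = restrict (\<lambda>v. v ! 0) (fst (Gpart \<mu>))"
  define m0 where "m0 = image_mset \<kappa> (mset_set (fst (Gpart \<mu>)))"
  have kap: "\<kappa> [i, j] = i" if "(i, j) \<in> boxes \<mu>" for i j
    using that by (simp add: \<kappa>_def Gpart_vertex_iff)
  have col: "\<kappa> \<in> colourings (Gpart \<mu>) m0"
  proof (rule Gpart_colouringI[where T = "\<lambda>c i. if i \<le> c then row \<mu> i else 0"])
    show "\<kappa> [i, j] \<le> c \<longleftrightarrow> j \<le> (if i \<le> c then row \<mu> i else 0)" if "(i, j) \<in> boxes \<mu>" for i j c
      using kap[OF that] that by (auto simp: boxes_iff)
    show "(if Suc i \<le> Suc c then row \<mu> (Suc i) else 0) \<le> (if i \<le> c then row \<mu> i else 0)" if "1 \<le> i" for c i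
      using row_antimono[OF assms(1) that] by simp
  qed (auto simp: \<kappa>_def m0_def Gpart_vertex_iff boxes_iff)
  have cnt: "count m0 i = row \<mu> i" if "1 \<le> i" for i
  proof -
    have "count m0 i = card {(i', j) \<in> boxes \<mu>. \<kappa> [i', j] = i}"
      by (simp add: m0_def count_image_mset_set[OF finite_Gpart] card_Gpart_Collect)
    also have "{(i', j) \<in> boxes \<mu>. \<kappa> [i', j] = i} = {i} \<times> {1..row \<mu> i}"
      using kap that by (auto simp: boxes_iff)
    finally show ?thesis by simp
  qed
  have z: "0 \<notin># m0" by (rule colourings_zero[OF finite_Gpart col])
  have set: "set_mset m0 = {1..<Suc (length \<mu>)}"
  proof (rule set_eqI)
    fix i
    have "i \<in># m0 \<longleftrightarrow> 1 \<le> i \<and> row \<mu> i \<noteq> 0"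
      using z cnt[of i] by (cases "i = 0") (auto simp flip: count_greater_zero_iff)
    also have "\<dots> \<longleftrightarrow> i \<in> {1..<Suc (length \<mu>)}"
      using assms(1) by (auto simp: row_def is_partition_def)
    finally show "i \<in># m0 \<longleftrightarrow> i \<in> {1..<Suc (length \<mu>)}" .
  qed
  have "comp_of m0 = \<mu>"
    unfolding comp_of_def set sorted_list_of_set_range
    by (rule nth_equalityI) (simp_all add: cnt row_def del: upt_Suc)
  then have "part_of m0 = \<mu>" using part_of_eqI[OF assms(1)] by simp
  then have "chromX (Gpart \<mu>) m = chromX (Gpart \<mu>) m0"
    by (intro symmetric_seriesD[OF chromX_Gpart_symmetric[OF assms(1)] assms(3) z]) (simp add: assms(2))
  then show ?thesis
    using col chromX_nonzero_iff[OF finite_Gpart, of \<mu> m] chromX_nonzero_iff[OF finite_Gpart, of \<mu> m0] by auto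
qed

subsection \<open>The four bases\<close>

text \<open>Summing partial sums turns strict dominance into a strict inequality of numbers;
  \<open>k\<close> up to \<open>n\<close> suffices because a partition of at most \<open>n\<close>
  has at most \<open>n\<close> parts.\<close>

definition comp_rank :: "nat \<Rightarrow> nat list \<times> nat list \<Rightarrow> nat" where
  "comp_rank n bm = length (fst bm) + (\<Sum>k\<le>n. sum_list (take k (snd bm)))"

lemma eq_of_sum_list_take_eq:
  fixes xs ys :: "nat list"
  assumes "\<And>k. sum_list (take k xs) = sum_list (take k ys)" "\<forall>x\<in>set xs. 0 < x" "\<forall>y\<in>set ys. 0 < y"
  shows "xs = ys"
  using assms
proof (induction xs arbitrary: ys)
  case Nil
  then show ?case using Nil(1)[of 1] by (cases ys) auto
next
  case (Cons x xs)
  then obtain y zs where ys: "ys = y # zs" using Cons.prems(1)[of 1] by (cases ys) auto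
  have "x = y" using Cons.prems(1)[of 1] ys by simp
  moreover have "sum_list (take k xs) = sum_list (take k zs)" for k
    using Cons.prems(1)[of "Suc k"] \<open>x = y\<close> ys by simp
  then have "xs = zs" using Cons.IH[of zs] Cons.prems(2,3) ys by simp
  ultimately show ?case using ys by simp
qed

text \<open>The common argument for the last three bases; \<open>P\<close> and \<open>Q\<close> are
  the composition side and the partition side.\<close>

lemma dashed_gsum_triangular:
  fixes P Q :: "nat list \<Rightarrow> egraph"
  assumes finP: "\<And>\<beta>. finite (fst (P \<beta>))" and finQ: "\<And>\<mu>. finite (fst (Q \<mu>))"
    and P_size: "\<And>\<beta> m. \<forall>b\<in>set \<beta>. 0 < b \<Longrightarrow> colourings (P \<beta>) m \<noteq> {} \<Longrightarrow> size m = sum_list \<beta>"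
    and P_count: "\<And>\<beta> m x. \<forall>b\<in>set \<beta>. 0 < b \<Longrightarrow> colourings (P \<beta>) m \<noteq> {} \<Longrightarrow> x \<in># m \<Longrightarrow>
      \<exists>b\<in>set \<beta>. b \<le> count m x"
    and P_length: "\<And>\<beta> m. \<forall>b\<in>set \<beta>. 0 < b \<Longrightarrow> colourings (P \<beta>) m \<noteq> {} \<Longrightarrow>
      length (comp_of m) < length \<beta> \<or> comp_of m = \<beta>"
    and P_diag: "\<And>m. 0 \<notin># m \<Longrightarrow> colourings (P (comp_of m)) m \<noteq> {}"
    and Q_size: "\<And>\<mu> m. is_partition \<mu> \<Longrightarrow> colourings (Q \<mu>) m \<noteq> {} \<Longrightarrow> size m = sum_list \<mu>"
    and Q_dominance: "\<And>\<mu> m k. is_partition \<mu> \<Longrightarrow> colourings (Q \<mu>) m \<noteq> {} \<Longrightarrow>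
      sum_list (take k (part_of m)) \<le> sum_list (take k \<mu>)"
    and Q_diag: "\<And>m. 0 \<notin># m \<Longrightarrow> colourings (Q (part_of m)) m \<noteq> {}"
    and Q_symmetric: "\<And>\<mu>. is_partition \<mu> \<Longrightarrow> symmetric_series (chromX (Q \<mu>))"
  shows "triangular_family (good n) (rtype r) (rcomps r n)
    (\<lambda>bm. chromX (gsum Dashed (P (fst bm)) (Q (snd bm)))) (comp_rank n)" (is "triangular_family _ _ _ ?b _")
proof -
  \<comment> \<open>Dominance at \<open>k = 1\<close> bounds each multiplicity by the largest part
    of \<open>\<mu>\<close>.\<close>
  have Q_count: "enat (count m x) < r"
    if h: "(\<beta>, \<mu>) \<in> rcomps r n" and c: "colourings (Q \<mu>) m \<noteq> {}" and x: "x \<in># m" for \<beta> \<mu> m x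
  proof -
    note R = rcompsD[OF h]
    obtain a as where p: "part_of m = a # as"
      using x sum_part_of[of m] by (cases "part_of m") auto
    have "count m x \<in> set (part_of m)" using x by (simp add: set_part_of)
    then have "count m x \<le> a"
      using is_partition_part_of[of m] p by (auto simp: is_partition_def)
    also have "\<dots> \<le> sum_list (take 1 \<mu>)" using Q_dominance[OF R(3) c, of 1] p by simp
    finally have "count m x \<le> sum_list (take 1 \<mu>)" .
    moreover have "0 < count m x" using x by simp
    ultimately obtain c cs where "\<mu> = c # cs" "count m x \<le> c" by (cases \<mu>) auto
    then show ?thesis using R(5) by (auto intro: le_less_trans[of _ "enat c"])
  qed
  have prod: "chromX (gsum Dashed (P \<beta>) (Q \<mu>)) m = chromX (P \<beta>) (big r m) * chromX (Q \<mu>) (small r m)"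
    if h: "(\<beta>, \<mu>) \<in> rcomps r n" for \<beta> \<mu> m
  proof (rule chromX_dashed_gsum[OF finP finQ])
    fix m x assume "colourings (P \<beta>) m \<noteq> {}" "x \<in># m"
    then obtain b where "b \<in> set \<beta>" "b \<le> count m x" using P_count[OF rcompsD(1)[OF h]] by blast
    then show "r \<le> enat (count m x)" using rcompsD(2)[OF h] by (auto intro: order_trans[of _ "enat b"])
  qed (rule Q_count[OF h])
  have nz: "?b (\<beta>, \<mu>) m \<noteq> 0 \<longleftrightarrow> colourings (P \<beta>) (big r m) \<noteq> {} \<and> colourings (Q \<mu>) (small r m) \<noteq> {}"
    if h: "(\<beta>, \<mu>) \<in> rcomps r n" for \<beta> \<mu> m
    by (simp add: prod[OF h] chromX_nonzero_iff[OF finP, symmetric] chromX_nonzero_iff[OF finQ, symmetric])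
  have zero: "0 \<notin># m \<longleftrightarrow> 0 \<notin># big r m \<and> 0 \<notin># small r m" for m
    by (metis big_plus_small union_iff)
  show ?thesis
  proof
    fix bm assume bm: "bm \<in> rcomps r n"
    then obtain \<beta> \<mu> where eq: "bm = (\<beta>, \<mu>)" and h: "(\<beta>, \<mu>) \<in> rcomps r n" by (cases bm) auto
    note R = rcompsD[OF h]
    show "?b bm \<in> class_series (good n) (rtype r)"
    proof (rule class_seriesI)
      show "?b bm m = 0" if "\<not> good n m" for m
      proof (rule ccontr)
        assume "?b bm m \<noteq> 0"
        then have c: "colourings (P \<beta>) (big r m) \<noteq> {}" "colourings (Q \<mu>) (small r m) \<noteq> {}"
          using nz[OF h, of m] eq by simp_all
        have "0 \<notin># big r m" "0 \<notin># small r m"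
          using c colourings_zero[OF finP] colourings_zero[OF finQ] by blast+
        then have "0 \<notin># m" using zero[of m] by blast
        moreover have "size m = n"
          using P_size[OF R(1) c(1)] Q_size[OF R(3) c(2)] R(6) arg_cong[OF big_plus_small[of r m], of size]
          by simp
        ultimately show False using that by (simp add: good_def)
      qed
      fix m m' assume m: "good n m" "good n m'" "rtype r m = rtype r m'"
      have z: "0 \<notin># big r m" "0 \<notin># small r m" "0 \<notin># big r m'" "0 \<notin># small r m'"
        using m(1,2) zero[of m] zero[of m'] unfolding good_def by blast+
      have t: "comp_of (big r m) = comp_of (big r m')" "part_of (small r m) = part_of (small r m')"
        using m(3) by (simp_all add: rtype_def)
      have "chromX (P \<beta>) (big r m) = chromX (P \<beta>) (big r m')"
        by (rule chromX_quasisymmetric[OF finP t(1) z(1,3)])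
      moreover have "chromX (Q \<mu>) (small r m) = chromX (Q \<mu>) (small r m')"
        by (rule symmetric_seriesD[OF Q_symmetric[OF R(3)] z(2,4) t(2)])
      ultimately show "?b bm m = ?b bm m'" by (simp add: eq prod[OF h])
    qed
    fix m assume m: "good n m" and "?b bm m \<noteq> 0"
    then have c: "colourings (P \<beta>) (big r m) \<noteq> {}" "colourings (Q \<mu>) (small r m) \<noteq> {}"
      using nz[OF h, of m] eq by simp_all
    define \<beta>' \<mu>' where "\<beta>' = comp_of (big r m)" and "\<mu>' = part_of (small r m)"
    have t: "rtype r m = (\<beta>', \<mu>')" by (simp add: rtype_def \<beta>'_def \<mu>'_def)
    have len: "length \<beta>' < length \<beta> \<or> \<beta>' = \<beta>" using P_length[OF R(1) c(1)] by (simp add: \<beta>'_def)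
    have dom: "sum_list (take k \<mu>') \<le> sum_list (take k \<mu>)" for k
      using Q_dominance[OF R(3) c(2)] by (simp add: \<mu>'_def)
    have sums: "(\<Sum>k\<le>n. sum_list (take k \<mu>')) \<le> (\<Sum>k\<le>n. sum_list (take k \<mu>))"
      by (rule sum_mono) (rule dom)
    show "rtype r m = bm \<or> comp_rank n (rtype r m) < comp_rank n bm"
    proof (rule disjCI)
      assume nless: "\<not> comp_rank n (rtype r m) < comp_rank n bm"
      then have "\<beta>' = \<beta>" using len sums by (auto simp: comp_rank_def t eq)
      then have "(\<Sum>k\<le>n. sum_list (take k \<mu>')) = (\<Sum>k\<le>n. sum_list (take k \<mu>))"
        using nless sums by (simp add: comp_rank_def t eq)
      \<comment> \<open>Termwise inequalities with equal totals are equalities.\<close>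
      then have take_eq: "sum_list (take k \<mu>') = sum_list (take k \<mu>)" if "k \<le> n" for k
        using sum_mono_inv[of "\<lambda>k. sum_list (take k \<mu>')" "{..n}" "\<lambda>k. sum_list (take k \<mu>)" k] dom that by auto
      have h': "(\<beta>', \<mu>') \<in> rcomps r n" using rtype_in_rcomps[OF m, of r] by (simp add: t)
      have l: "length \<mu> \<le> n" "length \<mu>' \<le> n"
        using length_le_sum_list[OF R(4)] R(6) length_le_sum_list[OF rcompsD(4)[OF h']] rcompsD(6)[OF h']
        by linarith+
      \<comment> \<open>Past \<open>n\<close> both prefixes are the whole lists, so the equality at
        \<open>n\<close> applies.\<close>
      have "sum_list (take k \<mu>') = sum_list (take k \<mu>)" for k
        using take_eq[of k] take_eq[of n] l by (cases "k \<le> n") auto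
      then have "\<mu>' = \<mu>" by (rule eq_of_sum_list_take_eq) (use R(4) rcompsD(4)[OF h'] in auto)
      then show "rtype r m = bm" using \<open>\<beta>' = \<beta>\<close> by (simp add: t eq)
    qed
  next
    fix m assume m: "good n m"
    have "0 \<notin># big r m" "0 \<notin># small r m" using m zero[of m] unfolding good_def by blast+
    then show "?b (rtype r m) m \<noteq> 0"
      using nz rtype_in_rcomps[OF m, of r] P_diag Q_diag by (simp add: rtype_def)
  qed (simp_all add: finite_rcomps rtype_in_rcomps ex_good_rtype)
qed

text \<open>No merging is possible in a dashed sum, so the dominance condition holds with
  equality.\<close>

lemma dashed_cycle_sum_part_of:
  assumes "is_partition \<mu>" "colourings (cycle_sum Dashed \<mu>) m \<noteq> {}" shows "part_of m = \<mu>"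
  using assms colourings_dashed_cycle_sum_iff[of \<mu> m]
  by (intro part_of_eqI) (auto simp: is_partition_def)

lemma cycle_sum_Gpart_triangular:
  assumes "k \<noteq> Dashed"
  shows "triangular_family (good n) (rtype r) (rcomps r n)
    (\<lambda>bm. chromX (gsum Dashed (cycle_sum k (fst bm)) (Gpart (snd bm)))) (comp_rank n)"
proof (rule dashed_gsum_triangular)
  show "size m = sum_list \<mu>" if "colourings (Gpart \<mu>) m \<noteq> {}" for \<mu> m
    using that colourings_size[of _ "Gpart \<mu>" m] card_Gpart[of \<mu>] by auto
  show "colourings (Gpart (part_of m)) m \<noteq> {}" if "0 \<notin># m" for m
    by (rule colourings_Gpart_of_part[OF is_partition_part_of refl that])
  show "colourings (cycle_sum k (comp_of m)) m \<noteq> {}" if "0 \<notin># m" for m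
    by (rule colourings_cycle_sum_of_comp[OF assms refl that])
  fix \<beta> :: "nat list" and m x
  assume "\<forall>b\<in>set \<beta>. 0 < b" "colourings (cycle_sum k \<beta>) m \<noteq> {}"
  note imp = colourings_cycle_sum_imp[OF assms this(2,1)]
  show "size m = sum_list \<beta>" "length (comp_of m) < length \<beta> \<or> comp_of m = \<beta>" by (rule imp)+
  show "\<exists>b\<in>set \<beta>. b \<le> count m x" if "x \<in># m" using imp(2) that by blast
qed (rule finite_cycle_sum finite_Gpart Gpart_dominance chromX_Gpart_symmetric; assumption)+

lemma cycle_sum_dashed_triangular:
  assumes "k \<noteq> Dashed"
  shows "triangular_family (good n) (rtype r) (rcomps r n)
    (\<lambda>bm. chromX (gsum Dashed (cycle_sum k (fst bm)) (cycle_sum Dashed (snd bm)))) (comp_rank n)"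
proof (rule dashed_gsum_triangular)
  fix \<mu> m i assume "is_partition \<mu>" "colourings (cycle_sum Dashed \<mu>) m \<noteq> {}"
  then have "part_of m = \<mu>" by (rule dashed_cycle_sum_part_of)
  then show "size m = sum_list \<mu>" "sum_list (take i (part_of m)) \<le> sum_list (take i \<mu>)"
    using sum_part_of[of m] by simp_all
next
  show "colourings (cycle_sum Dashed (part_of m)) m \<noteq> {}" if "0 \<notin># m" for m
  proof -
    have "\<forall>b\<in>set (part_of m). 0 < b" using is_partition_part_of by (simp add: is_partition_def)
    then show ?thesis using that by (simp add: colourings_dashed_cycle_sum_iff mset_part_of)
  qed
  show "colourings (cycle_sum k (comp_of m)) m \<noteq> {}" if "0 \<notin># m" for m
    by (rule colourings_cycle_sum_of_comp[OF assms refl that])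
  fix \<beta> :: "nat list" and m x
  assume "\<forall>b\<in>set \<beta>. 0 < b" "colourings (cycle_sum k \<beta>) m \<noteq> {}"
  note imp = colourings_cycle_sum_imp[OF assms this(2,1)]
  show "size m = sum_list \<beta>" "length (comp_of m) < length \<beta> \<or> comp_of m = \<beta>" by (rule imp)+
  show "\<exists>b\<in>set \<beta>. b \<le> count m x" if "x \<in># m" using imp(2) that by blast
qed (rule finite_cycle_sum chromX_dashed_cycle_sum_symmetric)+

theorem mainTheorem8:
  fixes r :: enat and n :: nat
  assumes "r \<ge> 1"
  shows "is_basis_family (QSym r n) Mser (rcomps r n) \<and>
         is_basis_family (QSym r n) Sser (rcomps r n) \<and>
         is_basis_family (QSym r n) Fbar (rcomps r n) \<and>
         is_basis_family (QSym r n) Sbar (rcomps r n)"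
proof -
  have S: "Sser = (\<lambda>bm. chromX (gsum Dashed (cycle_sum Solid (fst bm)) (Gpart (snd bm))))"
    and F: "Fbar = (\<lambda>bm. chromX (gsum Dashed (cycle_sum Double (fst bm)) (cycle_sum Dashed (snd bm))))"
    and S': "Sbar = (\<lambda>bm. chromX (gsum Dashed (cycle_sum Double (fst bm)) (Gpart (snd bm))))"
    by (simp_all add: fun_eq_iff Sser_def Fbar_def Sbar_def Agraph_def Bgraph_def Dgraph_def cycle_sum_def)
  note basis = triangular_family.basis[where P = "good n" and t = "rtype r" and I = "rcomps r n"]
  show ?thesis
    unfolding QSym_eq_class_series S F S'
    by (intro conjI basis[OF Mser_triangular] basis[OF cycle_sum_Gpart_triangular]
        basis[OF cycle_sum_dashed_triangular]) simp_all
qed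

end
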